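(* Let $n\ge1$ and $\alpha\in\mathbb{R}\setminus\pi\mathbb{Z}$. Assume that the classical low-frequency cutoff $S_0$ and dyadic blocks $\Delta_j$ satisfy the inhomogeneous Calderón reproducing formula, i.e. $S_0v+\sum_{j\ge1}\Delta_jv=v$ in $\mathcal S'(\mathbb{R}^n)$ for every tempered distribution $v$. Then for every tempered distribution $u\in\mathcal S'(\mathbb{R}^n)$, $$S_{0,\alpha}u+\sum_{j\ge1}\Delta_{j,\alpha}u=u\qquad\text{in }\mathcal S'(\mathbb{R}^n),$$ and in the homogeneous quotient, $$\sum_{j\in\mathbb{Z}}\Delta_{j,\alpha}u=u\qquad\text{in }\mathcal S'(\mathbb{R}^n)/\mathcal P_\alpha.$$
   Context: $M_\alpha f(x)=e^{i\pi|x|^2\cot\alpha}f(x)$, acting on tempered distributions, and $M_\alpha^{-1}$ is multiplication by $e^{-i\pi|x|^2\cot\alpha}$. With $\widehat f(\xi)=\int_{\mathbb{R}^n}e^{-2\pi ix\cdot\xi}f(x)\,dx$ and $\vee$ its inverse: fix $\varphi\in C_c^\infty(\mathbb{R}^n\setminus\{0\})$ supported in $\{\frac12\le|\xi|\le2\}$ with $\sum_{j\in\mathbb{Z}}\varphi(2^{-j}\xi)=1$ for $\xi\neq0$, and $\chi\in C_c^\infty(\mathbb{R}^n)$ supported in $\{|\xi|\le2\}$ and equal to $1$ on $\{|\xi|\le1\}$. Set $\Delta_jf:=(\varphi(2^{-j}\cdot)\widehat f)^\vee$ and $S_0f:=(\chi\widehat f)^\vee$, and $S_{0,\alpha}:=M_\alpha^{-1}S_0M_\alpha$,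 $\Delta_{j,\alpha}:=M_\alpha^{-1}\Delta_jM_\alpha$. $\mathcal P$ is the space of polynomials on $\mathbb{R}^n$ and $\mathcal P_\alpha:=M_\alpha^{-1}\mathcal P=\{e^{-i\pi|x|^2\cot\alpha}P(x):P\in\mathcal P\}$. Convergence in the quotient $\mathcal S'/\mathcal P_\alpha$ means convergence when tested against every Schwartz function $\psi$ that annihilates $\mathcal P_\alpha$, i.e. $\int e^{-i\pi|x|^2\cot\alpha}P(x)\psi(x)\,dx=0$ for all $P\in\mathcal P$. *)

theory Defs
  imports "HOL-Analysis.Analysis"
begin

definition partial_deriv :: "'n::finite \<Rightarrow> (real^'n \<Rightarrow> complex) \<Rightarrow> real^'n \<Rightarrow> complex" where
  "partial_deriv i f x = frechet_derivative f (at x) (axis i 1)"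

text \<open>Mixed partial derivatives are indexed by the list of directions of differentiation.\<close>

definition iter_deriv :: "'n::finite list \<Rightarrow> (real^'n \<Rightarrow> complex) \<Rightarrow> real^'n \<Rightarrow> complex" where
  "iter_deriv is f = foldr partial_deriv is f"

definition smooth :: "(real^'n::finite \<Rightarrow> complex) \<Rightarrow> bool" where
  "smooth f \<longleftrightarrow> (\<forall>is. iter_deriv is f differentiable_on UNIV)"

definition supp :: "(real^'n::finite \<Rightarrow> complex) \<Rightarrow> (real^'n) set" where
  "supp f = closure {x. f x \<noteq> 0}"

text \<open>A member of $C_c^\infty(U)$, for open $U$, is represented by its extension by zero.\<close>

definition Cc_infty :: "(real^'n::finite) set \<Rightarrow> (real^'n \<Rightarrow> complex) set" where
  "Cc_infty U = {f. smooth f \<and> compact (supp f) \<and> supp f \<subseteq> U}"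

definition schwartz :: "(real^'n::finite \<Rightarrow> complex) set" where
  "schwartz = {f. smooth f \<and>
     (\<forall>k is. bdd_above (range (\<lambda>x. (1 + norm x) ^ k * norm (iter_deriv is f x))))}"

definition schwartz_seminorm :: "nat \<Rightarrow> 'n::finite list \<Rightarrow> (real^'n \<Rightarrow> complex) \<Rightarrow> real" where
  "schwartz_seminorm k is f = (SUP x. (1 + norm x) ^ k * norm (iter_deriv is f x))"

text \<open>Distributions are functionals on all functions of which only the values on Schwartz
  functions matter; accordingly they are only ever compared on Schwartz functions. The pairing
  of a distribution with a test function is bilinear (no conjugation).\<close>

type_synonym 'n distribution = "(real^'n \<Rightarrow> complex) \<Rightarrow> complex"

definition tempered :: "'n::finite distribution \<Rightarrow> bool" where
  "tempered u \<longleftrightarrow>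
     (\<forall>f\<in>schwartz. \<forall>g\<in>schwartz. u (\<lambda>x. f x + g x) = u f + u g) \<and>
     (\<forall>c. \<forall>f\<in>schwartz. u (\<lambda>x. c * f x) = c * u f) \<and>
     (\<exists>C N. \<forall>f\<in>schwartz.
        norm (u f) \<le> C * (\<Sum>is\<in>{is. length is \<le> N}. schwartz_seminorm N is f))"

definition tempered_tendsto ::
    "('i \<Rightarrow> 'n::finite distribution) \<Rightarrow> 'n distribution \<Rightarrow> 'i filter \<Rightarrow> bool" where
  "tempered_tendsto T u F \<longleftrightarrow> (\<forall>\<psi>\<in>schwartz. ((\<lambda>i. T i \<psi>) \<longlongrightarrow> u \<psi>) F)"

definition fourier :: "(real^'n::finite \<Rightarrow> complex) \<Rightarrow> real^'n \<Rightarrow> complex" where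
  "fourier f \<xi> = (LINT x|lborel. exp (- 2 * of_real pi * \<i> * of_real (x \<bullet> \<xi>)) * f x)"

definition inv_fourier :: "(real^'n::finite \<Rightarrow> complex) \<Rightarrow> real^'n \<Rightarrow> complex" where
  "inv_fourier f x = (LINT \<xi>|lborel. exp (2 * of_real pi * \<i> * of_real (x \<bullet> \<xi>)) * f \<xi>)"

text \<open>The operations on distributions are defined by duality.\<close>

definition fourier_distr :: "'n::finite distribution \<Rightarrow> 'n distribution" where
  "fourier_distr u = (\<lambda>\<psi>. u (fourier \<psi>))"

definition inv_fourier_distr :: "'n::finite distribution \<Rightarrow> 'n distribution" where
  "inv_fourier_distr u = (\<lambda>\<psi>. u (inv_fourier \<psi>))"

definition mult_distr ::
    "(real^'n::finite \<Rightarrow> complex) \<Rightarrow> 'n distribution \<Rightarrow> 'n distribution" where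
  "mult_distr g u = (\<lambda>\<psi>. u (\<lambda>x. g x * \<psi> x))"

definition LP_low ::
    "(real^'n::finite \<Rightarrow> complex) \<Rightarrow> 'n distribution \<Rightarrow> 'n distribution" where
  "LP_low \<eta> u = inv_fourier_distr (mult_distr \<eta> (fourier_distr u))"

definition LP_block ::
    "(real^'n::finite \<Rightarrow> complex) \<Rightarrow> int \<Rightarrow> 'n distribution \<Rightarrow> 'n distribution" where
  "LP_block \<phi> j u =
     inv_fourier_distr (mult_distr (\<lambda>\<xi>. \<phi> ((2 powi (- j)) *\<^sub>R \<xi>)) (fourier_distr u))"

definition chirp :: "real \<Rightarrow> real^'n::finite \<Rightarrow> complex" where
  "chirp \<alpha> x = exp (\<i> * of_real (pi * (norm x)\<^sup>2 * cot \<alpha>))"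

definition inv_chirp :: "real \<Rightarrow> real^'n::finite \<Rightarrow> complex" where
  "inv_chirp \<alpha> x = exp (- \<i> * of_real (pi * (norm x)\<^sup>2 * cot \<alpha>))"

definition chirp_low ::
    "real \<Rightarrow> (real^'n::finite \<Rightarrow> complex) \<Rightarrow> 'n distribution \<Rightarrow> 'n distribution" where
  "chirp_low \<alpha> \<eta> u = mult_distr (inv_chirp \<alpha>) (LP_low \<eta> (mult_distr (chirp \<alpha>) u))"

definition chirp_block ::
    "real \<Rightarrow> (real^'n::finite \<Rightarrow> complex) \<Rightarrow> int \<Rightarrow> 'n distribution \<Rightarrow> 'n distribution" where
  "chirp_block \<alpha> \<phi> j u = mult_distr (inv_chirp \<alpha>) (LP_block \<phi> j (mult_distr (chirp \<alpha>) u))"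

text \<open>For complex-valued functions, \<^const>\<open>polynomial_function\<close> means that real and
  imaginary part are real polynomials, i.e. polynomials with complex coefficients.\<close>

definition chirp_polys :: "real \<Rightarrow> (real^'n::finite \<Rightarrow> complex) set" where
  "chirp_polys \<alpha> = {\<lambda>x. inv_chirp \<alpha> x * P x | P. polynomial_function P}"

definition quotient_tendsto ::
    "real \<Rightarrow> ('i \<Rightarrow> 'n::finite distribution) \<Rightarrow> 'n distribution \<Rightarrow> 'i filter \<Rightarrow> bool" where
  "quotient_tendsto \<alpha> T u F \<longleftrightarrow>
     (\<forall>\<psi>\<in>schwartz. (\<forall>p\<in>chirp_polys \<alpha>. (LINT x|lborel. p x * \<psi> x) = 0) \<longrightarrow>
        ((\<lambda>i. T i \<psi>) \<longlongrightarrow> u \<psi>) F)"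

end

(* The chirp is a multiplier of the Schwartz space, so v = M u is tempered and the inhomogeneous
   formula for u is the classical one for v tested against M^-1 psi. For the homogeneous formula,
   the classical formula is applied to the dilates of v: it identifies the sum of the blocks with
   indices above -k with v minus a low-frequency cutoff of v at scale 2^-k. This cutoff tends to 0
   on test functions whose moments all vanish. *)

theory Submission
  imports Defs
begin

section \<open>Schwartz functions and multipliers\<close>

text \<open>The obstacle is the vanishing of the low-frequency part. Since \<open>v\<close> is
  controlled only by finitely many Schwartz seminorms, pointwise smallness of the test function
  behind the cutoff is too weak: every derivative of it must tend to 0 under every polynomial
  weight. For a generic test function this fails, because a cutoff at scale r spreads its mass over
  distance 1/r, where a weight of order N has size r^-N. The vanishing moments make up for this
  loss. They are used on the kernel side: the Taylor polynomial of the dilated kernel is subtracted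
  for free, and its order can be taken as high as the weight demands. The kernel is the Fourier
  transform of a smooth compactly supported symbol, so the analytic input is decay of such
  transforms, with derivatives and Taylor remainders estimated explicitly. The other factor of the
  symbol, \<open>inv_fourier h\<close>, enters through a convolution formula in which only integrals
  of \<open>h\<close> against polynomial weights occur. In the quotient the two ends of the sum tend
  to infinity independently, so the sum is cut at frequency index 0 and each half gets its own
  limit.\<close>

lemma has_derivative_partial_deriv:
  "(f has_derivative f') (at x) \<Longrightarrow> partial_deriv i f x = f' (axis i 1)"
  by (simp add: partial_deriv_def frechet_derivative_at[symmetric])

lemma has_derivative_frechet_derivative:
  "f differentiable_on UNIV \<Longrightarrow> (f has_derivative frechet_derivative f (at x)) (at x)"
  by (simp add: differentiable_on_def frechet_derivative_works[symmetric])

lemma partial_deriv_add: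
  assumes "f differentiable_on UNIV" "g differentiable_on UNIV"
  shows "partial_deriv i (\<lambda>x. f x + g x) = (\<lambda>x. partial_deriv i f x + partial_deriv i g x)"
proof
  fix x
  show "partial_deriv i (\<lambda>x. f x + g x) x = partial_deriv i f x + partial_deriv i g x"
    using has_derivative_partial_deriv[OF has_derivative_add[OF
        has_derivative_frechet_derivative[OF assms(1)] has_derivative_frechet_derivative[OF assms(2)]], of i x]
    by (simp add: partial_deriv_def)
qed

lemma partial_deriv_mult:
  assumes "f differentiable_on UNIV" "g differentiable_on UNIV"
  shows "partial_deriv i (\<lambda>x. f x * g x) = (\<lambda>x. partial_deriv i f x * g x + f x * partial_deriv i g x)"
proof
  fix x
  show "partial_deriv i (\<lambda>x. f x * g x) x = partial_deriv i f x * g x + f x * partial_deriv i g x"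
    using has_derivative_partial_deriv[OF has_derivative_mult[OF
        has_derivative_frechet_derivative[OF assms(1)] has_derivative_frechet_derivative[OF assms(2)]], of i x]
    by (simp add: partial_deriv_def add.commute)
qed

lemma partial_deriv_const: "partial_deriv i (\<lambda>x. c) = (\<lambda>x. 0)"
  using has_derivative_partial_deriv[OF has_derivative_const] by fast

lemma partial_deriv_cmult:
  assumes "f differentiable_on UNIV"
  shows "partial_deriv i (\<lambda>x. c * f x) = (\<lambda>x. c * partial_deriv i f x)"
  using partial_deriv_mult[OF differentiable_on_const assms, of i c]
  by (simp add: partial_deriv_const)

lemma has_derivative_coord:
  "((\<lambda>x::real^'n::finite. complex_of_real (x $ i)) has_derivative (\<lambda>h. complex_of_real (h $ i))) (at x)"
  by (intro bounded_linear_imp_has_derivative bounded_linear_compose[OF bounded_linear_of_real]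
      bounded_linear_vec_nth)

lemma coord_differentiable: "(\<lambda>x::real^'n::finite. complex_of_real (x $ i)) differentiable_on UNIV"
  unfolding differentiable_on_def differentiable_def using has_derivative_coord by blast

lemma partial_deriv_coord:
  "partial_deriv j (\<lambda>x::real^'n::finite. complex_of_real (x $ i)) = (\<lambda>x. if i = j then 1 else 0)"
  by (rule ext, subst has_derivative_partial_deriv[OF has_derivative_coord]) (simp add: axis_def)

lemma partial_deriv_scale:
  assumes "f differentiable_on UNIV"
  shows "partial_deriv i (\<lambda>x. f (s *\<^sub>R x)) = (\<lambda>x. of_real s * partial_deriv i f (s *\<^sub>R x))"
proof
  fix x
  have "((\<lambda>x. f (s *\<^sub>R x)) has_derivative (\<lambda>h. frechet_derivative f (at (s *\<^sub>R x)) (s *\<^sub>R h))) (at x)"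
    by (rule has_derivative_compose[OF _ has_derivative_frechet_derivative[OF assms]])
       (auto intro!: derivative_eq_intros)
  from has_derivative_partial_deriv[OF this, of i]
  show "partial_deriv i (\<lambda>x. f (s *\<^sub>R x)) x = of_real s * partial_deriv i f (s *\<^sub>R x)"
    using linear_scale[OF has_derivative_linear[OF has_derivative_frechet_derivative[OF assms]]]
    by (simp add: partial_deriv_def scaleR_conv_of_real)
qed

text \<open>\<open>smooth\<close> quantifies over lists of directions, which does not combine well
  with the product and chain rules. Recursion on the order removes the innermost derivative first,
  so that these rules apply to f itself. The top order here is differentiability of the n-th
  partials, so \<open>Ck n\<close> is not the classical class C^n, but the two scales have the same
  intersection.\<close>

primrec Ck :: "nat \<Rightarrow> (real^'n::finite \<Rightarrow> complex) \<Rightarrow> bool" where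
  "Ck 0 f \<longleftrightarrow> f differentiable_on UNIV"
| "Ck (Suc n) f \<longleftrightarrow> f differentiable_on UNIV \<and> (\<forall>i. Ck n (partial_deriv i f))"

lemma iter_deriv_Nil [simp]: "iter_deriv [] f = f"
  by (simp add: iter_deriv_def)

text \<open>\<open>foldr\<close> applies the last entry first: appending exposes the innermost
  derivative, consing the outermost. Leibniz and dilation rules use the former, closed classes of
  functions and Fourier symbols the latter.\<close>

lemma iter_deriv_snoc [simp]: "iter_deriv (is @ [i]) f = iter_deriv is (partial_deriv i f)"
  by (simp add: iter_deriv_def)

lemma iter_deriv_Cons: "iter_deriv (i # is) f = partial_deriv i (iter_deriv is f)"
  by (simp add: iter_deriv_def)

lemma Ck_iff: "Ck n f \<longleftrightarrow> (\<forall>is. length is \<le> n \<longrightarrow> iter_deriv is f differentiable_on UNIV)"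
proof (induction n arbitrary: f)
  case (Suc n)
  show ?case
  proof
    assume *: "Ck (Suc n) f"
    show "\<forall>is. length is \<le> Suc n \<longrightarrow> iter_deriv is f differentiable_on UNIV"
    proof (intro allI impI)
      fix "is" :: "'a list" assume "length is \<le> Suc n"
      then show "iter_deriv is f differentiable_on UNIV"
        using * Suc.IH by (cases "is" rule: rev_cases) auto
    qed
  next
    assume *: "\<forall>is. length is \<le> Suc n \<longrightarrow> iter_deriv is f differentiable_on UNIV"
    have "Ck n (partial_deriv i f)" for i
      unfolding Suc.IH using *[rule_format, of "_ @ [i]"] by simp
    then show "Ck (Suc n) f" using *[rule_format, of "[]"] by simp
  qed
qed simp

lemma smooth_iff_Ck: "smooth f \<longleftrightarrow> (\<forall>n. Ck n f)"
  unfolding smooth_def Ck_iff by blast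

lemma smooth_differentiable: "smooth f \<Longrightarrow> f differentiable_on UNIV"
  unfolding smooth_iff_Ck by (metis Ck.simps(1))

lemma smooth_continuous: "smooth f \<Longrightarrow> continuous_on UNIV f"
  by (rule differentiable_imp_continuous_on[OF smooth_differentiable])

lemma smooth_partial_deriv: "smooth f \<Longrightarrow> smooth (partial_deriv i f)"
  unfolding smooth_iff_Ck by (metis Ck.simps(2))

text \<open>Induction on n shows that every member of \<open>S\<close> is \<open>Ck n\<close>. It
  replaces explicit formulas for higher derivatives, which would be unwieldy for chirps, by the
  choice of a class closed under differentiation.\<close>

lemma smooth_coinduct:
  assumes "f \<in> S" "\<And>g. g \<in> S \<Longrightarrow> g differentiable_on UNIV" "\<And>g i. g \<in> S \<Longrightarrow> partial_deriv i g \<in> S"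
  shows "smooth f"
proof -
  have "g \<in> S \<Longrightarrow> Ck n g" for n g
    using assms(2,3) by (induction n arbitrary: g) auto
  then show ?thesis using assms(1) by (simp add: smooth_iff_Ck)
qed

lemma Ck_add: "Ck n f \<Longrightarrow> Ck n g \<Longrightarrow> Ck n (\<lambda>x. f x + g x)"
  by (induction n arbitrary: f g) (auto simp: partial_deriv_add differentiable_on_add)

lemma Ck_SucD: "Ck (Suc n) f \<Longrightarrow> Ck n f"
  by (auto simp: Ck_iff)

lemma Ck_mult: "Ck n f \<Longrightarrow> Ck n g \<Longrightarrow> Ck n (\<lambda>x. f x * g x)"
proof (induction n arbitrary: f g)
  case (Suc n)
  then have "f differentiable_on UNIV" "g differentiable_on UNIV" "Ck n f" "Ck n g"
    by (auto intro: Ck_SucD simp del: Ck.simps(2)) (simp_all)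
  with Suc show ?case by (auto simp: partial_deriv_mult intro!: Ck_add derivative_intros)
qed (auto intro: derivative_intros)

lemma smooth_mult: "smooth f \<Longrightarrow> smooth g \<Longrightarrow> smooth (\<lambda>x. f x * g x)"
  by (simp add: smooth_iff_Ck Ck_mult)

lemma smooth_const: "smooth (\<lambda>x. c)"
  by (rule smooth_coinduct[of _ "range (\<lambda>c x. c)"]) (auto simp: partial_deriv_const)

lemma smooth_coord: "smooth (\<lambda>x. complex_of_real (x $ i))"
proof -
  have "Ck n (\<lambda>x. complex_of_real (x $ i))" for n
    using smooth_const by (cases n) (auto simp: coord_differentiable partial_deriv_coord smooth_iff_Ck)
  then show ?thesis by (simp add: smooth_iff_Ck)
qed

lemma iter_deriv_add:
  assumes "smooth f" "smooth g"
  shows "iter_deriv is (\<lambda>x. f x + g x) = (\<lambda>x. iter_deriv is f x + iter_deriv is g x)"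
  using assms
  by (induction "is" arbitrary: f g rule: rev_induct)
     (auto simp: partial_deriv_add smooth_differentiable smooth_partial_deriv)

lemma iter_deriv_cmult:
  assumes "smooth f"
  shows "iter_deriv is (\<lambda>x. c * f x) = (\<lambda>x. c * iter_deriv is f x)"
  using assms
  by (induction "is" arbitrary: f rule: rev_induct)
     (auto simp: partial_deriv_cmult smooth_differentiable smooth_partial_deriv)

lemma smooth_scale: "smooth f \<Longrightarrow> smooth (\<lambda>x. f (s *\<^sub>R x))"
proof -
  have "Ck n f \<Longrightarrow> Ck n (\<lambda>x. f (s *\<^sub>R x))" for n
  proof (induction n arbitrary: f)
    case 0
    then show ?case
      by (auto simp: differentiable_on_def intro!: differentiable_compose[of f "(*\<^sub>R) s"] derivative_intros)
  next
    case (Suc n)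
    have "(\<lambda>x. f (s *\<^sub>R x)) differentiable_on UNIV"
      using Suc.prems
      by (auto simp: differentiable_on_def intro!: differentiable_compose[of f "(*\<^sub>R) s"] derivative_intros)
    moreover have "Ck n (\<lambda>x. c)" for c :: complex
      using smooth_const smooth_iff_Ck by blast
    ultimately show ?case using Suc by (auto simp: partial_deriv_scale intro!: Ck_mult)
  qed
  then show "smooth f \<Longrightarrow> ?thesis" by (simp add: smooth_iff_Ck)
qed

lemma iter_deriv_scale:
  assumes "smooth f"
  shows "iter_deriv is (\<lambda>x. f (s *\<^sub>R x)) = (\<lambda>x. of_real (s ^ length is) * iter_deriv is f (s *\<^sub>R x))"
  using assms
proof (induction "is" arbitrary: f rule: rev_induct)
  case (snoc i "is")
  have "iter_deriv (is @ [i]) (\<lambda>x. f (s *\<^sub>R x))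
      = iter_deriv is (\<lambda>x. of_real s * partial_deriv i f (s *\<^sub>R x))"
    using snoc.prems by (simp add: partial_deriv_scale smooth_differentiable)
  also have "\<dots> = (\<lambda>x. of_real s * iter_deriv is (\<lambda>x. partial_deriv i f (s *\<^sub>R x)) x)"
    using snoc.prems by (intro iter_deriv_cmult smooth_scale smooth_partial_deriv)
  finally show ?case using snoc.IH[OF smooth_partial_deriv[OF snoc.prems]] by (simp add: mult.assoc)
qed simp

section \<open>Schwartz norms and operators bounded by them\<close>

definition schwartz_norm :: "nat \<Rightarrow> (real^'n::finite \<Rightarrow> complex) \<Rightarrow> real" where
  "schwartz_norm N f = (\<Sum>is\<in>{is. length is \<le> N}. schwartz_seminorm N is f)"

lemma finite_multi_indices: "finite {is :: 'n::finite list. length is \<le> N}"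
  using finite_lists_length_le[of "UNIV :: 'n set" N] by simp

lemma schwartzD:
  "f \<in> schwartz \<Longrightarrow> smooth f"
  "f \<in> schwartz \<Longrightarrow> bdd_above (range (\<lambda>x. (1 + norm x) ^ k * norm (iter_deriv is f x)))"
  by (auto simp: schwartz_def)

lemma schwartzI:
  assumes "smooth f" "\<And>k is. \<exists>C. \<forall>x. (1 + norm x) ^ k * norm (iter_deriv is f x) \<le> C"
  shows "f \<in> schwartz"
  unfolding schwartz_def bdd_above_def using assms by fast

lemma schwartz_seminorm_upper:
  assumes "f \<in> schwartz"
  shows "(1 + norm x) ^ k * norm (iter_deriv is f x) \<le> schwartz_seminorm k is f"
  unfolding schwartz_seminorm_def by (rule cSUP_upper[OF _ schwartzD(2)[OF assms]]) simp

lemma schwartz_seminorm_nonneg: "f \<in> schwartz \<Longrightarrow> 0 \<le> schwartz_seminorm k is f"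
  by (rule order_trans[OF _ schwartz_seminorm_upper[of f 0]]) simp_all

lemma schwartz_seminorm_least:
  assumes "\<And>x. (1 + norm x) ^ k * norm (iter_deriv is f x) \<le> B"
  shows "schwartz_seminorm k is f \<le> B"
  unfolding schwartz_seminorm_def by (rule cSUP_least) (use assms in auto)

lemma schwartz_norm_nonneg: "f \<in> schwartz \<Longrightarrow> 0 \<le> schwartz_norm N f"
  unfolding schwartz_norm_def by (auto intro!: sum_nonneg schwartz_seminorm_nonneg)

lemma schwartz_norm_upper:
  assumes "f \<in> schwartz" "k \<le> N" "length is \<le> N"
  shows "(1 + norm x) ^ k * norm (iter_deriv is f x) \<le> schwartz_norm N f"
proof -
  have "(1 + norm x) ^ k * norm (iter_deriv is f x) \<le> (1 + norm x) ^ N * norm (iter_deriv is f x)"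
    using assms(2) by (intro mult_right_mono power_increasing) auto
  also have "\<dots> \<le> schwartz_seminorm N is f"
    by (rule schwartz_seminorm_upper[OF assms(1)])
  also have "\<dots> \<le> schwartz_norm N f"
    unfolding schwartz_norm_def using assms
    by (intro member_le_sum) (auto intro: schwartz_seminorm_nonneg finite_multi_indices)
  finally show ?thesis .
qed

text \<open>Each summand is bounded separately, so the constant merely counts the seminorms of order
  at most \<open>N\<close>. Such crude constants are harmless, as only their finiteness matters
  later.\<close>

lemma schwartz_norm_le_card:
  fixes f :: "real^'n::finite \<Rightarrow> complex"
  assumes "\<And>is x. length is \<le> N \<Longrightarrow> (1 + norm x) ^ N * norm (iter_deriv is f x) \<le> B"
  shows "schwartz_norm N f \<le> real (card {is :: 'n list. length is \<le> N}) * B"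
  unfolding schwartz_norm_def
  using sum_bounded_above[of "{is :: 'n list. length is \<le> N}" "\<lambda>is. schwartz_seminorm N is f" B]
    schwartz_seminorm_least assms by fastforce

lemma schwartz_norm_partial_deriv:
  fixes f :: "real^'n::finite \<Rightarrow> complex"
  assumes "f \<in> schwartz"
  shows "schwartz_norm N (partial_deriv i f)
      \<le> real (card {is :: 'n list. length is \<le> N}) * schwartz_norm (Suc N) f"
proof (rule schwartz_norm_le_card)
  fix x and "is" :: "'n list" assume "length is \<le> N"
  then show "(1 + norm x) ^ N * norm (iter_deriv is (partial_deriv i f) x) \<le> schwartz_norm (Suc N) f"
    using schwartz_norm_upper[OF assms, of N "Suc N" "is @ [i]" x] by simp
qed

lemma schwartz_norm_mono:
  fixes f :: "real^'n::finite \<Rightarrow> complex"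
  assumes "f \<in> schwartz" "N \<le> M"
  shows "schwartz_norm N f \<le> real (card {is :: 'n list. length is \<le> N}) * schwartz_norm M f"
  by (intro schwartz_norm_le_card schwartz_norm_upper) (use assms in auto)

lemma schwartz_partial_deriv: "f \<in> schwartz \<Longrightarrow> partial_deriv i f \<in> schwartz"
proof (rule schwartzI)
  fix k "is" assume "f \<in> schwartz"
  then show "\<exists>C. \<forall>x. (1 + norm x) ^ k * norm (iter_deriv is (partial_deriv i f) x) \<le> C"
    using schwartz_seminorm_upper[of f _ k "is @ [i]"] by auto
qed (auto dest: schwartzD intro: smooth_partial_deriv)

text \<open>Derivatives are meant to be put inside the operator: boundedness of
  \<open>\<lambda>f. iter_deriv is (T f)\<close> for every list \<open>is\<close> is continuity of
  \<open>T\<close> on the Schwartz space. The constants depend on the weight \<open>k\<close> but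
  neither on the function nor on the point.\<close>

definition schwartz_bounded ::
    "((real^'n::finite \<Rightarrow> complex) \<Rightarrow> real^'n \<Rightarrow> complex) \<Rightarrow> bool" where
  "schwartz_bounded T \<longleftrightarrow> (\<forall>k. \<exists>C M. C \<ge> 0 \<and>
     (\<forall>f\<in>schwartz. \<forall>x. (1 + norm x) ^ k * norm (T f x) \<le> C * schwartz_norm M f))"

lemma schwartz_bounded_add:
  fixes S T :: "(real^'n::finite \<Rightarrow> complex) \<Rightarrow> real^'n \<Rightarrow> complex"
  assumes "schwartz_bounded S" "schwartz_bounded T"
  shows "schwartz_bounded (\<lambda>f x. S f x + T f x)"
  unfolding schwartz_bounded_def
proof
  fix k
  obtain C M where C: "C \<ge> 0"
    "\<And>f x. f \<in> schwartz \<Longrightarrow> (1 + norm x) ^ k * norm (S f x) \<le> C * schwartz_norm M f"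
    using assms(1) unfolding schwartz_bounded_def by blast
  obtain D L where D: "D \<ge> 0"
    "\<And>f x. f \<in> schwartz \<Longrightarrow> (1 + norm x) ^ k * norm (T f x) \<le> D * schwartz_norm L f"
    using assms(2) unfolding schwartz_bounded_def by blast
  let ?a = "real (card {is :: 'n list. length is \<le> M})" and ?b = "real (card {is :: 'n list. length is \<le> L})"
  have "(1 + norm x) ^ k * norm (S f x + T f x) \<le> (C * ?a + D * ?b) * schwartz_norm (max M L) f"
    if f: "f \<in> schwartz" for f x
  proof -
    have "(1 + norm x) ^ k * norm (S f x + T f x)
        \<le> (1 + norm x) ^ k * norm (S f x) + (1 + norm x) ^ k * norm (T f x)"
      by (metis add_increasing distrib_left mult_left_mono norm_ge_zero norm_triangle_ineq
          zero_le_one zero_le_power)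
    also have "\<dots> \<le> C * schwartz_norm M f + D * schwartz_norm L f"
      using C(2) D(2) f by (intro add_mono)
    also have "\<dots> \<le> C * (?a * schwartz_norm (max M L) f) + D * (?b * schwartz_norm (max M L) f)"
      using C(1) D(1) f by (intro add_mono mult_left_mono schwartz_norm_mono) auto
    finally show ?thesis by (simp add: algebra_simps)
  qed
  then show "\<exists>C M. C \<ge> 0 \<and> (\<forall>f\<in>schwartz. \<forall>x.
      (1 + norm x) ^ k * norm (S f x + T f x) \<le> C * schwartz_norm M f)"
    using C(1) D(1) by (intro exI[of _ "C * ?a + D * ?b"] exI[of _ "max M L"]) auto
qed

lemma schwartz_bounded_partial_deriv:
  fixes T :: "(real^'n::finite \<Rightarrow> complex) \<Rightarrow> real^'n \<Rightarrow> complex"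
  assumes "schwartz_bounded T"
  shows "schwartz_bounded (\<lambda>f. T (partial_deriv i f))"
  unfolding schwartz_bounded_def
proof
  fix k
  obtain C M where C: "C \<ge> 0"
    "\<And>f x. f \<in> schwartz \<Longrightarrow> (1 + norm x) ^ k * norm (T f x) \<le> C * schwartz_norm M f"
    using assms unfolding schwartz_bounded_def by blast
  let ?a = "real (card {is :: 'n list. length is \<le> M})"
  have "(1 + norm x) ^ k * norm (T (partial_deriv i f) x) \<le> (C * ?a) * schwartz_norm (Suc M) f"
    if f: "f \<in> schwartz" for f x
    using C(2)[OF schwartz_partial_deriv[OF f, of i], of x]
      mult_left_mono[OF schwartz_norm_partial_deriv[OF f, of M i] C(1)] by (simp add: mult.assoc)
  then show "\<exists>C M. C \<ge> 0 \<and> (\<forall>f\<in>schwartz. \<forall>x.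
      (1 + norm x) ^ k * norm (T (partial_deriv i f) x) \<le> C * schwartz_norm M f)"
    using C(1) by (intro exI[of _ "C * ?a"] exI[of _ "Suc M"]) auto
qed

section \<open>Multipliers of the Schwartz space and their action on tempered distributions\<close>

definition multiplier :: "(real^'n::finite \<Rightarrow> complex) \<Rightarrow> bool" where
  "multiplier m \<longleftrightarrow> smooth m \<and> (\<forall>is. \<exists>K C. \<forall>x. norm (iter_deriv is m x) \<le> C * (1 + norm x) ^ K)"

lemma multiplier_partial_deriv: "multiplier m \<Longrightarrow> multiplier (partial_deriv i m)"
  unfolding multiplier_def by (metis smooth_partial_deriv iter_deriv_snoc)

text \<open>Leibniz for the innermost derivative leaves two products of the same kind: in one,
  \<open>m\<close> is replaced by its partial derivative, again a multiplier; in the other, f is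
  replaced by its partial derivative, which costs one order of the Schwartz norm. Hence the
  induction must run over all multipliers at once.\<close>

lemma multiplier_schwartz_bounded:
  assumes "multiplier m"
  shows "schwartz_bounded (\<lambda>f. iter_deriv is (\<lambda>x. m x * f x))"
  using assms
proof (induction "is" arbitrary: m rule: rev_induct)
  case Nil
  obtain K C where C: "norm (m x) \<le> C * (1 + norm x) ^ K" for x
    using Nil unfolding multiplier_def by (metis iter_deriv_Nil)
  have "C \<ge> 0" using C[of 0] order_trans[OF norm_ge_zero] by fastforce
  show ?case unfolding schwartz_bounded_def
  proof
    fix k
    have "(1 + norm x) ^ k * norm (m x * f x) \<le> C * schwartz_norm (K + k) f"
      if f: "f \<in> schwartz" for f x
    proof -
      have "(1 + norm x) ^ k * norm (m x * f x) \<le> (1 + norm x) ^ k * (C * (1 + norm x) ^ K * norm (f x))"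
        unfolding norm_mult using C by (intro mult_left_mono mult_right_mono) auto
      also have "\<dots> = C * ((1 + norm x) ^ (K + k) * norm (f x))"
        by (simp add: power_add)
      also have "\<dots> \<le> C * schwartz_norm (K + k) f"
        using schwartz_norm_upper[OF f, of "K + k" "K + k" "[]" x] \<open>C \<ge> 0\<close>
        by (intro mult_left_mono) auto
      finally show ?thesis .
    qed
    then show "\<exists>C M. C \<ge> 0 \<and> (\<forall>f\<in>schwartz. \<forall>x.
      (1 + norm x) ^ k * norm (iter_deriv [] (\<lambda>x. m x * f x) x) \<le> C * schwartz_norm M f)"
      using \<open>C \<ge> 0\<close> by auto
  qed
next
  case (snoc i "is")
  have m: "smooth m" using snoc.prems by (simp add: multiplier_def)
  have "iter_deriv (is @ [i]) (\<lambda>x. m x * f x) = (\<lambda>x. iter_deriv is (\<lambda>x. partial_deriv i m x * f x) x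
      + iter_deriv is (\<lambda>x. m x * partial_deriv i f x) x)" if "f \<in> schwartz" for f
    using m schwartzD(1)[OF that]
    by (simp add: partial_deriv_mult smooth_differentiable iter_deriv_add smooth_mult smooth_partial_deriv)
  moreover have "schwartz_bounded (\<lambda>f x. iter_deriv is (\<lambda>x. partial_deriv i m x * f x) x
      + iter_deriv is (\<lambda>x. m x * partial_deriv i f x) x)"
    by (intro schwartz_bounded_add snoc.IH[OF multiplier_partial_deriv[OF snoc.prems]]
        schwartz_bounded_partial_deriv[OF snoc.IH[OF snoc.prems]])
  ultimately show ?case unfolding schwartz_bounded_def by simp
qed

lemma schwartz_mult:
  assumes "multiplier m" "f \<in> schwartz"
  shows "(\<lambda>x. m x * f x) \<in> schwartz"
proof (rule schwartzI)
  show "smooth (\<lambda>x. m x * f x)"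
    using assms by (intro smooth_mult) (auto simp: multiplier_def schwartz_def)
  show "\<exists>C. \<forall>x. (1 + norm x) ^ k * norm (iter_deriv is (\<lambda>x. m x * f x) x) \<le> C" for k "is"
    using multiplier_schwartz_bounded[OF assms(1), of "is"] assms(2)
    unfolding schwartz_bounded_def by blast
qed

text \<open>If \<open>\<partial>\<^sub>i a = c x\<^sub>i a\<close> for all \<open>i\<close>, the polynomial multiples of \<open>a\<close> are closed under partial
  derivatives, so all derivatives of \<open>a\<close> grow at most polynomially.\<close>

inductive_set modulated :: "(real^'n::finite \<Rightarrow> complex) \<Rightarrow> (real^'n \<Rightarrow> complex) set" for a where
  base: "a \<in> modulated a"
| coord: "f \<in> modulated a \<Longrightarrow> (\<lambda>x. complex_of_real (x $ i) * f x) \<in> modulated a"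
| cmult: "f \<in> modulated a \<Longrightarrow> (\<lambda>x. c * f x) \<in> modulated a"
| add: "f \<in> modulated a \<Longrightarrow> g \<in> modulated a \<Longrightarrow> (\<lambda>x. f x + g x) \<in> modulated a"

lemma modulated_differentiable:
  assumes "a differentiable_on UNIV"
  shows "f \<in> modulated a \<Longrightarrow> f differentiable_on UNIV"
  by (induction rule: modulated.induct)
     (auto intro!: assms differentiable_on_mult differentiable_on_add coord_differentiable)

lemma modulated_partial_deriv:
  assumes "a differentiable_on UNIV"
    and "\<And>i. partial_deriv i a = (\<lambda>x. c * (complex_of_real (x $ i) * a x))"
  shows "f \<in> modulated a \<Longrightarrow> partial_deriv j f \<in> modulated a"
proof (induction rule: modulated.induct)
  case base
  then show ?case unfolding assms(2) by (intro modulated.intros)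
next
  case (coord f i)
  have "partial_deriv j (\<lambda>x. complex_of_real (x $ i) * f x)
     = (\<lambda>x. (if i = j then 1 else 0) * f x + complex_of_real (x $ i) * partial_deriv j f x)"
    using partial_deriv_mult[OF coord_differentiable modulated_differentiable[OF assms(1) coord(1)]]
    by (simp add: partial_deriv_coord)
  then show ?case using coord by (simp only:) (intro modulated.intros)
next
  case (cmult f c)
  then show ?case
    using partial_deriv_cmult[OF modulated_differentiable[OF assms(1)], of f j c]
    by (simp add: modulated.intros)
next
  case (add f g)
  then show ?case
    using partial_deriv_add[of f g j] modulated_differentiable[OF assms(1)]
    by (simp add: modulated.intros)
qed

lemma modulated_growth:
  assumes "\<And>x. norm (a x) \<le> 1"
  shows "f \<in> modulated a \<Longrightarrow> \<exists>K C. C \<ge> 0 \<and> (\<forall>x. norm (f x) \<le> C * (1 + norm x) ^ K)"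
proof (induction rule: modulated.induct)
  case base
  show ?case using assms by (intro exI[of _ 0] exI[of _ 1]) simp
next
  case (coord f i)
  then obtain K C where C: "C \<ge> 0" "\<And>x. norm (f x) \<le> C * (1 + norm x) ^ K" by blast
  have "norm (complex_of_real (x $ i) * f x) \<le> C * (1 + norm x) ^ Suc K" for x
  proof -
    have "norm (complex_of_real (x $ i) * f x) \<le> (1 + norm x) * (C * (1 + norm x) ^ K)"
      unfolding norm_mult using component_le_norm_cart[of x i] C by (intro mult_mono) auto
    then show ?thesis by (simp add: mult_ac)
  qed
  then show ?case using C(1) by blast
next
  case (cmult f c)
  then obtain K C where C: "C \<ge> 0" "\<And>x. norm (f x) \<le> C * (1 + norm x) ^ K" by blast
  then show ?case
    by (intro exI[of _ K] exI[of _ "norm c * C"])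
       (auto simp: norm_mult mult.assoc intro: mult_left_mono)
next
  case (add f g)
  then obtain K C L D where C: "C \<ge> 0" "\<And>x. norm (f x) \<le> C * (1 + norm x) ^ K"
    "D \<ge> 0" "\<And>x. norm (g x) \<le> D * (1 + norm x) ^ L" by blast
  have "norm (f x + g x) \<le> (C + D) * (1 + norm x) ^ (K + L)" for x
  proof -
    have "norm (f x + g x) \<le> C * (1 + norm x) ^ K + D * (1 + norm x) ^ L"
      using C norm_triangle_mono by blast
    also have "\<dots> \<le> C * (1 + norm x) ^ (K + L) + D * (1 + norm x) ^ (K + L)"
      using C by (intro add_mono mult_left_mono power_increasing) auto
    finally show ?thesis by (simp add: algebra_simps)
  qed
  then show ?case using C by (intro exI[of _ "K + L"] exI[of _ "C + D"]) auto
qed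

lemma multiplier_modulation:
  assumes "a differentiable_on UNIV" "\<And>x. norm (a x) \<le> 1"
    and "\<And>i. partial_deriv i a = (\<lambda>x. c * (complex_of_real (x $ i) * a x))"
  shows "multiplier a"
proof -
  have "smooth a"
    by (rule smooth_coinduct[of _ "modulated a"])
       (auto intro: modulated.base modulated_differentiable modulated_partial_deriv assms)
  moreover have "iter_deriv is a \<in> modulated a" for "is"
    by (induction "is")
       (auto simp: iter_deriv_Cons intro: modulated.base modulated_partial_deriv assms)
  ultimately show ?thesis
    unfolding multiplier_def using modulated_growth[of a, OF assms(2)] by blast
qed

text \<open>The gradient of c |x|^2 is 2 c x, so this function satisfies the differential equation
  of \<open>multiplier_modulation\<close> with constant 2 i c; it has modulus 1 because c is real.
  The two chirps are the cases c = pi cot alpha and c = - pi cot alpha.\<close>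

lemma multiplier_gauss:
  "multiplier (\<lambda>x::real^'n::finite. exp (\<i> * of_real (c * (norm x)\<^sup>2)))"
proof (rule multiplier_modulation)
  have *: "((\<lambda>x::real^'n. exp (\<i> * of_real (c * (norm x)\<^sup>2))) has_derivative
     (\<lambda>h. exp (\<i> * of_real (c * (norm x)\<^sup>2)) * (\<i> * of_real (c * (2 * (x \<bullet> h)))))) (at x)" for x
  proof -
    have "((\<lambda>x::real^'n. c * (norm x)\<^sup>2) has_derivative (\<lambda>h. c * (2 * (x \<bullet> h)))) (at x)"
      unfolding power2_norm_eq_inner by (auto intro!: derivative_eq_intros simp: inner_commute)
    then show ?thesis
      by (intro has_derivative_compose[where g = exp, OF has_derivative_mult_right]
          has_derivative_of_real has_field_derivative_imp_has_derivative DERIV_exp)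
  qed
  show "(\<lambda>x::real^'n. exp (\<i> * of_real (c * (norm x)\<^sup>2))) differentiable_on UNIV"
    unfolding differentiable_on_def differentiable_def using * by blast
  show "partial_deriv i (\<lambda>x::real^'n. exp (\<i> * of_real (c * (norm x)\<^sup>2)))
     = (\<lambda>x. (2 * \<i> * of_real c) * (complex_of_real (x $ i) * exp (\<i> * of_real (c * (norm x)\<^sup>2))))" for i
    by (rule ext, subst has_derivative_partial_deriv[OF *]) (simp add: inner_axis)
qed simp

lemma multiplier_chirp: "multiplier (chirp \<alpha>)" and multiplier_inv_chirp: "multiplier (inv_chirp \<alpha>)"
  using multiplier_gauss[of "pi * cot \<alpha>"] multiplier_gauss[of "- pi * cot \<alpha>"]
  unfolding chirp_def[abs_def] inv_chirp_def[abs_def] by (simp_all add: mult_ac)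

text \<open>Operations on distributions are transposes of operations on test functions, so
  continuity of the latter has to be converted into a single estimate of the form demanded by
  \<open>tempered\<close>. It is used for multiplication and for dilation.\<close>

lemma tempered_compose:
  fixes u :: "'n::finite distribution"
  assumes u: "tempered u"
    and T: "\<And>f. f \<in> schwartz \<Longrightarrow> T f \<in> schwartz"
    and add: "\<And>f g. T (\<lambda>x. f x + g x) = (\<lambda>x. T f x + T g x)"
    and cmult: "\<And>c f. T (\<lambda>x. c * f x) = (\<lambda>x. c * T f x)"
    and bdd: "\<And>is. schwartz_bounded (\<lambda>f. iter_deriv is (T f))"
  shows "tempered (\<lambda>f. u (T f))"
proof -
  obtain C N where C: "\<And>f. f \<in> schwartz \<Longrightarrow> norm (u f) \<le> C * schwartz_norm N f"
    using u unfolding tempered_def schwartz_norm_def by blast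
  have "\<exists>D M. D \<ge> 0 \<and> (\<forall>f\<in>schwartz. \<forall>x.
      (1 + norm x) ^ N * norm (iter_deriv is (T f) x) \<le> D * schwartz_norm M f)" for "is"
    using bdd[of "is"] unfolding schwartz_bounded_def by blast
  then obtain D M where D: "\<And>is. D is \<ge> 0"
    "\<And>is f x. f \<in> schwartz \<Longrightarrow>
      (1 + norm x) ^ N * norm (iter_deriv is (T f) x) \<le> D is * schwartz_norm (M is) f"
    by metis
  let ?I = "{is :: 'n list. length is \<le> N}"
  \<comment> \<open>Each derivative of \<open>T f\<close> comes with its own order
    \<open>M is\<close>. The sum of these finitely many orders dominates each of them, and
    \<open>B\<close> collects the constants, including the price of raising every order to
    \<open>L\<close>.\<close>
  define L where "L = (\<Sum>is\<in>?I. M is)"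
  define B where "B = (\<Sum>is\<in>?I. D is * real (card {js :: 'n list. length js \<le> M is}))"
  have M_le_L: "M js \<le> L" if "js \<in> ?I" for js
    unfolding L_def using that by (intro member_le_sum finite_multi_indices) auto
  have TB: "schwartz_norm N (T f) \<le> B * schwartz_norm L f" if f: "f \<in> schwartz" for f
    unfolding schwartz_norm_def[of N] B_def sum_distrib_right
  proof (rule sum_mono)
    fix "is" assume i: "is \<in> ?I"
    show "schwartz_seminorm N is (T f) \<le> D is * real (card {js :: 'n list. length js \<le> M is}) * schwartz_norm L f"
    proof (rule schwartz_seminorm_least)
      fix x
      have "(1 + norm x) ^ N * norm (iter_deriv is (T f) x) \<le> D is * schwartz_norm (M is) f"
        by (rule D(2)[OF f])
      also have "\<dots> \<le> D is * (real (card {js :: 'n list. length js \<le> M is}) * schwartz_norm L f)"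
        by (intro mult_left_mono D schwartz_norm_mono f M_le_L i)
      finally show "(1 + norm x) ^ N * norm (iter_deriv is (T f) x)
          \<le> D is * real (card {js :: 'n list. length js \<le> M is}) * schwartz_norm L f" by (simp add: mult.assoc)
    qed
  qed
  have B0: "B \<ge> 0" unfolding B_def using D by (intro sum_nonneg) auto
  have "norm (u (T f)) \<le> \<bar>C\<bar> * B * schwartz_norm (L) f" if f: "f \<in> schwartz" for f
  proof -
    have "norm (u (T f)) \<le> C * schwartz_norm N (T f)" by (rule C[OF T[OF f]])
    also have "\<dots> \<le> \<bar>C\<bar> * schwartz_norm N (T f)"
      by (intro mult_right_mono schwartz_norm_nonneg T f) auto
    also have "\<dots> \<le> \<bar>C\<bar> * (B * schwartz_norm L f)"
      by (intro mult_left_mono TB f) auto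
    finally show ?thesis by (simp add: mult.assoc)
  qed
  then show ?thesis
    using u T unfolding tempered_def add cmult schwartz_norm_def[symmetric] by blast
qed

lemma tempered_mult_distr:
  assumes "multiplier m" "tempered u"
  shows "tempered (mult_distr m u)"
  unfolding mult_distr_def
  by (rule tempered_compose[OF assms(2)])
     (auto intro!: schwartz_mult multiplier_schwartz_bounded assms simp: distrib_left mult.left_commute)

lemma schwartz_bounded_scale:
  assumes "s > 0"
  shows "schwartz_bounded (\<lambda>f. iter_deriv is (\<lambda>x. f (s *\<^sub>R x)))"
  unfolding schwartz_bounded_def
proof
  fix k
  define N where "N = max k (length is)"
  \<comment> \<open>Chosen so that 1 + |x| is at most this constant times 1 + |s x|; the entry 1/s
    matters when s < 1.\<close>
  let ?c = "max 1 (1 / s)"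
  have "(1 + norm x) ^ k * norm (iter_deriv is (\<lambda>x. f (s *\<^sub>R x)) x)
      \<le> (?c ^ k * s ^ length is) * schwartz_norm N f" if f: "f \<in> schwartz" for f x
  proof -
    have "1 + norm x \<le> ?c * (1 + norm (s *\<^sub>R x))"
      using assms mult_right_mono[of 1 s "norm x"] by (auto simp: max_def field_simps)
    then have "(1 + norm x) ^ k \<le> ?c ^ k * (1 + norm (s *\<^sub>R x)) ^ k"
      by (subst power_mult_distrib[symmetric]) (rule power_mono, auto)
    then have "(1 + norm x) ^ k * (s ^ length is * norm (iter_deriv is f (s *\<^sub>R x)))
       \<le> (?c ^ k * (1 + norm (s *\<^sub>R x)) ^ k) * (s ^ length is * norm (iter_deriv is f (s *\<^sub>R x)))"
      using assms by (intro mult_right_mono) auto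
    also have "\<dots> = (?c ^ k * s ^ length is) * ((1 + norm (s *\<^sub>R x)) ^ k * norm (iter_deriv is f (s *\<^sub>R x)))"
      by (simp add: mult_ac)
    also have "\<dots> \<le> (?c ^ k * s ^ length is) * schwartz_norm N f"
      using assms by (intro mult_left_mono schwartz_norm_upper[OF f]) (auto simp: N_def)
    finally show ?thesis
      using schwartzD(1)[OF f] assms by (simp add: iter_deriv_scale norm_mult norm_power)
  qed
  then show "\<exists>C M. C \<ge> 0 \<and> (\<forall>f\<in>schwartz. \<forall>x.
      (1 + norm x) ^ k * norm (iter_deriv is (\<lambda>x. f (s *\<^sub>R x)) x) \<le> C * schwartz_norm M f)"
    using assms by (intro exI[of _ "?c ^ k * s ^ length is"] exI[of _ N]) auto
qed

lemma schwartz_scale: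
  assumes "s > 0" "f \<in> schwartz"
  shows "(\<lambda>x. f (s *\<^sub>R x)) \<in> schwartz"
proof (rule schwartzI)
  show "smooth (\<lambda>x. f (s *\<^sub>R x))" using assms by (intro smooth_scale schwartzD)
  show "\<exists>C. \<forall>x. (1 + norm x) ^ k * norm (iter_deriv is (\<lambda>x. f (s *\<^sub>R x)) x) \<le> C" for k "is"
    using schwartz_bounded_scale[OF assms(1), of "is"] assms(2)
    unfolding schwartz_bounded_def by blast
qed

text \<open>These are the dilates of \<open>v\<close> to which the reproducing formula is later
  applied. The dilation carries no Jacobian factor; \<open>dilation_conjugates_symbol\<close> shows
  that this is the right normalisation.\<close>

lemma tempered_scale:
  assumes "s > 0" "tempered u"
  shows "tempered (\<lambda>f. u (\<lambda>x. f (s *\<^sub>R x)))"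
  by (rule tempered_compose[OF assms(2)])
     (auto intro: schwartz_scale schwartz_bounded_scale assms)

section \<open>The Fourier transform of rapidly decaying functions\<close>

lemma integral_lborel_scale:
  fixes f :: "'a::euclidean_space \<Rightarrow> 'b::{banach, second_countable_topology}"
  assumes [measurable]: "f \<in> borel_measurable borel" and "s > 0"
  shows "(LINT x|lborel. f x) = (s ^ DIM('a)) *\<^sub>R (LINT x|lborel. f (s *\<^sub>R x))"
proof -
  have "(LINT x|lborel. f x)
      = (LINT x|density (distr lborel borel (\<lambda>x. 0 + s *\<^sub>R x)) (\<lambda>_. \<bar>s\<bar> ^ DIM('a)). f x)"
    using assms by (subst lborel_affine[of s 0]) auto
  also have "\<dots> = (s ^ DIM('a)) *\<^sub>R (LINT x|lborel. f (s *\<^sub>R x))"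
    using assms by (subst integral_density) (auto simp: integral_distr)
  finally show ?thesis .
qed

lemma integral_lborel_translate:
  fixes f :: "'a::euclidean_space \<Rightarrow> 'b::{banach, second_countable_topology}"
  assumes [measurable]: "f \<in> borel_measurable borel"
  shows "(LINT x|lborel. f x) = (LINT x|lborel. f (a + x))"
  by (subst lborel_distr_plus[of a, symmetric], subst integral_distr) auto

text \<open>On the shell k <= |x| <= k+1 the integrand is at most (k+1)^-(d+2), where d is the
  dimension, while the ball of radius k+1 has volume proportional to (k+1)^d. The integral is
  therefore dominated by a multiple of the sum of (k+1)^-2, and this is where the exponent d+2 comes
  from.\<close>

lemma integrable_one_plus_norm_power:
  "integrable lborel (\<lambda>x::'a::euclidean_space. 1 / (1 + norm x) ^ (DIM('a) + 2))"
proof (rule integrableI_bounded)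
  let ?d = "DIM('a)"
  let ?v = "unit_ball_vol (real ?d)"
  have le_suminf: "f k \<le> suminf f" for f :: "nat \<Rightarrow> ennreal" and k
    using sum_le_suminf[of f "{k}"] by (simp add: summableI)
  have arith: "1 / K ^ (d + 2) * (v * K ^ d) = v * inverse (K ^ 2)" if "K > 0" for K v :: real and d
    using that by (simp add: power_add divide_simps power2_eq_square)
  have bound: "ennreal (1 / (1 + norm x) ^ (?d + 2))
      \<le> (\<Sum>k. ennreal (1 / real (Suc k) ^ (?d + 2)) * indicator (cball 0 (real (Suc k))) x)" for x :: 'a
  proof -
    define k where "k = nat \<lfloor>norm x\<rfloor>"
    have k: "real k \<le> norm x" "norm x \<le> real (Suc k)"
      unfolding k_def by (auto simp: real_nat_ceiling_ge) linarith+
    have "1 / (1 + norm x) ^ (?d + 2) \<le> 1 / real (Suc k) ^ (?d + 2)"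
      using k by (intro divide_left_mono power_mono mult_pos_pos zero_less_power) auto
    then have "ennreal (1 / (1 + norm x) ^ (?d + 2))
        \<le> ennreal (1 / real (Suc k) ^ (?d + 2)) * indicator (cball 0 (real (Suc k))) x"
      using k by (auto simp: indicator_def intro: ennreal_leI)
    also have "\<dots> \<le> (\<Sum>k. ennreal (1 / real (Suc k) ^ (?d + 2)) * indicator (cball 0 (real (Suc k))) x)"
      by (rule le_suminf[of "\<lambda>k. ennreal (1 / real (Suc k) ^ (?d + 2)) * indicator (cball 0 (real (Suc k))) x"])
    finally show ?thesis .
  qed
  have "(\<integral>\<^sup>+x. ennreal (norm (1 / (1 + norm x) ^ (?d + 2))) \<partial>(lborel :: 'a measure))
     \<le> (\<integral>\<^sup>+x. (\<Sum>k. ennreal (1 / real (Suc k) ^ (?d + 2)) * indicator (cball (0::'a) (real (Suc k))) x) \<partial>lborel)"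
    by (intro nn_integral_mono) (use bound in simp)
  also have "\<dots> = (\<Sum>k. ennreal (1 / real (Suc k) ^ (?d + 2)) * emeasure lborel (cball (0::'a) (real (Suc k))))"
    by (subst nn_integral_suminf)
       (auto intro!: borel_measurable_times_ennreal borel_measurable_indicator simp: nn_integral_cmult_indicator)
  also have "\<dots> = (\<Sum>k. ennreal (?v * inverse (real (Suc k) ^ 2)))"
  proof (rule suminf_cong)
    fix k
    show "ennreal (1 / real (Suc k) ^ (?d + 2)) * emeasure lborel (cball (0::'a) (real (Suc k)))
        = ennreal (?v * inverse (real (Suc k) ^ 2))"
      using arith[of "real (Suc k)" ?d ?v]
      by (subst emeasure_cball) (simp_all only: ennreal_mult''[symmetric] of_nat_0_le_iff of_nat_0_less_iff zero_less_Suc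
          mult_nonneg_nonneg unit_ball_vol_nonneg zero_le_power)
  qed
  also have "\<dots> < \<infinity>"
  proof -
    have "summable (\<lambda>k. inverse (real (Suc k) ^ 2))"
      using inverse_power_summable[of 2] by (subst summable_Suc_iff) auto
    then show ?thesis
      by (subst suminf_ennreal2) (auto intro!: summable_mult)
  qed
  finally show "(\<integral>\<^sup>+x. ennreal (norm (1 / (1 + norm x) ^ (?d + 2))) \<partial>(lborel :: 'a measure)) < \<infinity>" .
qed measurable

text \<open>Decay is measured by weighted integrals. This is what differentiating a Fourier integral
  arbitrarily often consumes, and it survives multiplication by measurable functions of polynomial
  growth. The class thus contains both the Schwartz functions and the products of a cutoff symbol
  with \<open>inv_fourier h\<close>.\<close>

definition rapid :: "(real^'n::finite \<Rightarrow> complex) \<Rightarrow> bool" where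
  "rapid h \<longleftrightarrow> h \<in> borel_measurable borel \<and> (\<forall>k. integrable lborel (\<lambda>x. (1 + norm x) ^ k * norm (h x)))"

lemma rapid_measurable: "rapid h \<Longrightarrow> h \<in> borel_measurable borel"
  by (simp add: rapid_def)

lemma rapid_weighted_integrable:
  "rapid h \<Longrightarrow> integrable lborel (\<lambda>x. (1 + norm x) ^ k * norm (h x))"
  by (simp add: rapid_def)

lemma rapid_integrable: "rapid h \<Longrightarrow> integrable lborel h"
  using rapid_weighted_integrable[of h 0] rapid_measurable[of h] by (simp add: integrable_norm_iff)

lemma rapid_mult:
  assumes h: "rapid h" and c [measurable]: "c \<in> borel_measurable borel"
    and C: "\<And>x. norm (c x) \<le> C * (1 + norm x) ^ k"
  shows "rapid (\<lambda>x. c x * h x)"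
  unfolding rapid_def
proof (intro conjI allI)
  note [measurable] = rapid_measurable[OF h]
  show "(\<lambda>x. c x * h x) \<in> borel_measurable borel" by measurable
  show "integrable lborel (\<lambda>x. (1 + norm x) ^ l * norm (c x * h x))" for l
  proof (rule Bochner_Integration.integrable_bound)
    show "integrable lborel (\<lambda>x. C * ((1 + norm x) ^ (k + l) * norm (h x)))"
      by (intro integrable_mult_right rapid_weighted_integrable h)
    have "norm ((1 + norm x) ^ l * norm (c x * h x)) \<le> norm (C * ((1 + norm x) ^ (k + l) * norm (h x)))" for x
    proof -
      have "norm ((1 + norm x) ^ l * norm (c x * h x)) = (1 + norm x) ^ l * (norm (c x) * norm (h x))"
        by (simp add: norm_mult)
      also have "\<dots> \<le> (1 + norm x) ^ l * (C * (1 + norm x) ^ k * norm (h x))"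
        by (intro mult_left_mono mult_right_mono C) auto
      also have "\<dots> = C * ((1 + norm x) ^ (k + l) * norm (h x))" by (simp add: power_add mult_ac)
      finally show ?thesis by simp
    qed
    then show "AE x in lborel. norm ((1 + norm x) ^ l * norm (c x * h x))
        \<le> norm (C * ((1 + norm x) ^ (k + l) * norm (h x)))" by simp
  qed measurable
qed

lemma rapid_mult_coord: "rapid h \<Longrightarrow> rapid (\<lambda>x. complex_of_real (x $ i) * h x)"
proof (rule rapid_mult[where C = 1 and k = 1])
  show "norm (complex_of_real (x $ i)) \<le> 1 * (1 + norm x) ^ 1" for x
    using component_le_norm_cart[of x i] by simp
qed (auto intro: borel_measurable_continuous_onI continuous_intros)

lemma rapid_mult_inner: "rapid h \<Longrightarrow> rapid (\<lambda>x. complex_of_real (y \<bullet> x) * h x)"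
proof (rule rapid_mult[where C = "norm y" and k = 1])
  show "norm (complex_of_real (y \<bullet> x)) \<le> norm y * (1 + norm x) ^ 1" for x
    using Cauchy_Schwarz_ineq2[of y x] by (simp add: distrib_left add_increasing)
qed (auto intro: borel_measurable_continuous_onI continuous_intros)

lemma rapid_cmult: "rapid h \<Longrightarrow> rapid (\<lambda>x. c * h x)"
  by (rule rapid_mult[where C = "norm c" and k = 0]) auto

lemma rapid_power_inner: "rapid h \<Longrightarrow> rapid (\<lambda>x. complex_of_real (y \<bullet> x) ^ m * h x)"
  by (induction m) (auto simp: mult.assoc intro: rapid_mult_inner)

lemma schwartz_rapid:
  fixes f :: "real^'n::finite \<Rightarrow> complex"
  assumes f: "f \<in> schwartz"
  shows "rapid f"
  unfolding rapid_def
proof (intro conjI allI)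
  show f_meas [measurable]: "f \<in> borel_measurable borel"
    by (rule borel_measurable_continuous_onI[OF smooth_continuous[OF schwartzD(1)[OF f]]])
  fix k
  \<comment> \<open>These surplus powers of the weight are the ones that
    \<open>integrable_one_plus_norm_power\<close> makes integrable.\<close>
  let ?m = "DIM(real^'n) + 2"
  let ?C = "schwartz_seminorm (k + ?m) [] f"
  show "integrable lborel (\<lambda>x. (1 + norm x) ^ k * norm (f x))"
  proof (rule Bochner_Integration.integrable_bound)
    show "integrable lborel (\<lambda>x::real^'n. ?C * (1 / (1 + norm x) ^ ?m))"
      by (intro integrable_mult_right integrable_one_plus_norm_power)
    have "norm ((1 + norm x) ^ k * norm (f x)) \<le> norm (?C * (1 / (1 + norm x) ^ ?m))" for x
    proof -
      have "(1 + norm x) ^ k * norm (f x) * (1 + norm x) ^ ?m \<le> ?C"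
        using schwartz_seminorm_upper[OF f, of x "k + ?m" "[]"] by (simp add: power_add mult_ac)
      moreover have "(1 + norm x) ^ ?m > 0" by (intro zero_less_power add_pos_nonneg) auto
      ultimately show ?thesis
        using schwartz_seminorm_nonneg[OF f] by (simp add: pos_le_divide_eq abs_mult)
    qed
    then show "AE x in lborel. norm ((1 + norm x) ^ k * norm (f x)) \<le> norm (?C * (1 / (1 + norm x) ^ ?m))"
      by simp
  qed measurable
qed

lemma norm_exp_phase [simp]:
  "norm (exp (- 2 * of_real pi * \<i> * of_real t)) = 1"
  "norm (exp (- (2 * of_real pi * \<i> * of_real t))) = 1"
  "norm (exp (2 * of_real pi * \<i> * of_real t)) = 1"
  by (simp_all add: norm_exp)

lemma integrable_phase:
  assumes "rapid h"
  shows "integrable lborel (\<lambda>\<xi>. exp (- 2 * of_real pi * \<i> * of_real (\<xi> \<bullet> x)) * h \<xi>)"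
    and "integrable lborel (\<lambda>\<xi>. exp (2 * of_real pi * \<i> * of_real (x \<bullet> \<xi>)) * h \<xi>)"
  by (intro rapid_integrable rapid_mult[where C = 1 and k = 0] assms;
      auto intro!: borel_measurable_continuous_onI continuous_intros)+

lemma fourier_norm_le:
  assumes "rapid h"
  shows "norm (fourier h x) \<le> (LINT \<xi>|lborel. norm (h \<xi>))"
  unfolding fourier_def
  by (rule order_trans[OF integral_norm_bound]) (simp add: norm_mult)

lemma inv_fourier_norm_le:
  assumes "rapid h"
  shows "norm (inv_fourier h x) \<le> (LINT \<xi>|lborel. norm (h \<xi>))"
  unfolding inv_fourier_def
  by (rule order_trans[OF integral_norm_bound]) (simp add: norm_mult)

lemma inv_fourier_measurable:
  assumes "rapid h"
  shows "inv_fourier h \<in> borel_measurable borel"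
proof -
  note [measurable] = rapid_measurable[OF assms]
  show ?thesis unfolding inv_fourier_def[abs_def]
    by (intro lborel.borel_measurable_lebesgue_integral[simplified]) measurable
qed

lemma fourier_add:
  assumes "rapid g" "rapid h"
  shows "fourier (\<lambda>\<xi>. g \<xi> + h \<xi>) x = fourier g x + fourier h x"
  unfolding fourier_def using integrable_phase(1)[OF assms(1), of x] integrable_phase(1)[OF assms(2), of x]
  by (simp add: distrib_left)

lemma fourier_cmult: "fourier (\<lambda>\<xi>. c * h \<xi>) x = c * fourier h x"
  unfolding fourier_def by (simp add: mult.left_commute[of _ c])

lemma fourier_sum:
  assumes "\<And>i. i \<in> A \<Longrightarrow> rapid (h i)"
  shows "fourier (\<lambda>\<xi>. \<Sum>i\<in>A. h i \<xi>) x = (\<Sum>i\<in>A. fourier (h i) x)"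
  unfolding fourier_def using integrable_phase(1)[OF assms] by (simp add: sum_distrib_left)

text \<open>Differentiation under the integral with an explicit remainder. The second-order error of
  the exponential is at most (2 pi)^2 |y - x|^2 |xi|^2, and the second weighted moment of
  \<open>h\<close> is finite, so the error of the linear approximation is quadratic in |y -
  x|.\<close>

lemma has_derivative_fourier:
  fixes h :: "real^'n::finite \<Rightarrow> complex"
  assumes h: "rapid h"
  shows "(fourier h has_derivative
    (\<lambda>v. fourier (\<lambda>\<xi>. (- 2 * of_real pi * \<i>) * (complex_of_real (v \<bullet> \<xi>) * h \<xi>)) x)) (at x)"
proof -
  define L where "L v = fourier (\<lambda>\<xi>. (- 2 * of_real pi * \<i>) * (complex_of_real (v \<bullet> \<xi>) * h \<xi>)) x" for v
  have L: "L v = (- 2 * of_real pi * \<i>) * fourier (\<lambda>\<xi>. complex_of_real (v \<bullet> \<xi>) * h \<xi>) x" for v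
    unfolding L_def by (rule fourier_cmult)
  have rv: "rapid (\<lambda>\<xi>. complex_of_real (v \<bullet> \<xi>) * h \<xi>)" for v by (rule rapid_mult_inner[OF h])
  define K1 where "K1 = (LINT \<xi>|lborel. (1 + norm \<xi>) ^ 1 * norm (h \<xi>))"
  have bl: "bounded_linear L"
  proof (rule bounded_linear_intro)
    show "L (v + w) = L v + L w" for v w
      using fourier_add[OF rv rv, of v w x] unfolding L by (simp add: inner_add_left distrib_right distrib_left)
    show "L (r *\<^sub>R v) = r *\<^sub>R L v" for r v
      using fourier_cmult[of "of_real r" "\<lambda>\<xi>. complex_of_real (v \<bullet> \<xi>) * h \<xi>" x]
      unfolding L by (simp add: scaleR_conv_of_real[where 'a = complex] mult.assoc)
    show "norm (L v) \<le> norm v * (2 * pi * K1)" for v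
    proof -
      have "norm (fourier (\<lambda>\<xi>. complex_of_real (v \<bullet> \<xi>) * h \<xi>) x)
          \<le> (LINT \<xi>|lborel. norm (complex_of_real (v \<bullet> \<xi>) * h \<xi>))"
        by (rule fourier_norm_le[OF rv])
      also have "\<dots> \<le> (LINT \<xi>|lborel. norm v * ((1 + norm \<xi>) ^ 1 * norm (h \<xi>)))"
      proof (rule integral_mono)
        show "integrable lborel (\<lambda>\<xi>. norm (complex_of_real (v \<bullet> \<xi>) * h \<xi>))"
          by (intro integrable_norm rapid_integrable rv)
        show "integrable lborel (\<lambda>\<xi>. norm v * ((1 + norm \<xi>) ^ 1 * norm (h \<xi>)))"
          by (intro integrable_mult_right rapid_weighted_integrable h)
        show "norm (complex_of_real (v \<bullet> \<xi>) * h \<xi>) \<le> norm v * ((1 + norm \<xi>) ^ 1 * norm (h \<xi>))" for \<xi>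
        proof -
          have "\<bar>v \<bullet> \<xi>\<bar> \<le> norm v * (1 + norm \<xi>)"
            using Cauchy_Schwarz_ineq2[of v \<xi>] by (simp add: distrib_left add_increasing)
          then show ?thesis by (simp add: norm_mult mult.assoc[symmetric] mult_right_mono)
        qed
      qed
      also have "\<dots> = norm v * K1" by (simp add: K1_def)
      finally show ?thesis unfolding L by (simp add: norm_mult mult_ac)
    qed
  qed
  define K2 where "K2 = (LINT \<xi>|lborel. (2 * pi)\<^sup>2 * ((1 + norm \<xi>) ^ 2 * norm (h \<xi>)))"
  have est: "norm (fourier h y - fourier h x - L (y - x)) \<le> (norm (y - x))\<^sup>2 * K2" for y
  proof -
    define v where "v = y - x"
    let ?c = "- 2 * of_real pi * \<i>"
    let ?e = "\<lambda>\<xi>. exp (?c * of_real (\<xi> \<bullet> x))"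
    have taylor_alg: "e * Z * w - e * w - e * (c * (a * w)) = e * (Z - (1 + c * a)) * w"
      for e Z w c a :: complex by (simp add: algebra_simps)
    note int = integrable_phase(1)[OF h, of y] integrable_phase(1)[OF h, of x]
      integrable_phase(1)[OF rapid_cmult[OF rv], of x ?c v]
    have eq: "fourier h y - fourier h x - L v
      = (LINT \<xi>|lborel. exp (?c * of_real (\<xi> \<bullet> y)) * h \<xi> - ?e \<xi> * h \<xi>
           - ?e \<xi> * (?c * (complex_of_real (v \<bullet> \<xi>) * h \<xi>)))"
      unfolding L_def fourier_def
      by (simp only: Bochner_Integration.integral_diff[OF int(1,2)]
          Bochner_Integration.integral_diff[OF Bochner_Integration.integrable_diff[OF int(1,2)] int(3)])
    have "norm (fourier h y - fourier h x - L v)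
        \<le> (LINT \<xi>|lborel. (norm v)\<^sup>2 * ((2 * pi)\<^sup>2 * ((1 + norm \<xi>) ^ 2 * norm (h \<xi>))))"
      unfolding eq
    proof (rule order_trans[OF integral_norm_bound], rule integral_mono')
      show "integrable lborel (\<lambda>\<xi>. (norm v)\<^sup>2 * ((2 * pi)\<^sup>2 * ((1 + norm \<xi>) ^ 2 * norm (h \<xi>))))"
        by (intro integrable_mult_right rapid_weighted_integrable h)
      fix \<xi>
      let ?z = "?c * of_real (v \<bullet> \<xi>)"
      have y: "\<xi> \<bullet> y = \<xi> \<bullet> x + v \<bullet> \<xi>" by (simp add: v_def inner_diff inner_commute)
      have "exp (?c * of_real (\<xi> \<bullet> y)) = ?e \<xi> * exp ?z"
        unfolding y of_real_add distrib_left exp_add ..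
      then have "exp (?c * of_real (\<xi> \<bullet> y)) * h \<xi> - ?e \<xi> * h \<xi>
           - ?e \<xi> * (?c * (complex_of_real (v \<bullet> \<xi>) * h \<xi>)) = ?e \<xi> * (exp ?z - (1 + ?z)) * h \<xi>"
        by (simp only: taylor_alg)
      then have "norm (exp (?c * of_real (\<xi> \<bullet> y)) * h \<xi> - ?e \<xi> * h \<xi>
           - ?e \<xi> * (?c * (complex_of_real (v \<bullet> \<xi>) * h \<xi>))) = norm (exp ?z - (1 + ?z)) * norm (h \<xi>)"
        by (simp add: norm_mult)
      \<comment> \<open>The bound of \<open>Taylor_exp\<close> carries the exponential of |Re z| as
        a factor; it equals 1 because z is purely imaginary.\<close>
      also have "\<dots> \<le> (norm ?z)\<^sup>2 * norm (h \<xi>)"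
        using Taylor_exp[of ?z 1] by (intro mult_right_mono) (auto simp: power2_eq_square)
      also have "\<dots> \<le> (norm v)\<^sup>2 * ((2 * pi)\<^sup>2 * ((1 + norm \<xi>) ^ 2)) * norm (h \<xi>)"
      proof (rule mult_right_mono)
        have "\<bar>v \<bullet> \<xi>\<bar> \<le> norm v * (1 + norm \<xi>)"
          using Cauchy_Schwarz_ineq2[of v \<xi>] by (simp add: distrib_left add_increasing)
        then have "norm ?z \<le> norm v * ((2 * pi) * (1 + norm \<xi>))"
          unfolding mult.left_commute[of "norm v" "2 * pi"] by (simp add: norm_mult mult_left_mono del: mult_le_cancel_left_pos)
        then show "(norm ?z)\<^sup>2 \<le> (norm v)\<^sup>2 * ((2 * pi)\<^sup>2 * ((1 + norm \<xi>) ^ 2))"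
          unfolding power_mult_distrib[symmetric] by (rule power_mono) simp
      qed simp
      finally show "norm (exp (?c * of_real (\<xi> \<bullet> y)) * h \<xi> - ?e \<xi> * h \<xi>
           - ?e \<xi> * (?c * (complex_of_real (v \<bullet> \<xi>) * h \<xi>)))
         \<le> (norm v)\<^sup>2 * ((2 * pi)\<^sup>2 * ((1 + norm \<xi>) ^ 2 * norm (h \<xi>)))" by (simp only: mult.assoc)
    next
      show "0 \<le> (norm v)\<^sup>2 * ((2 * pi)\<^sup>2 * ((1 + norm \<xi>) ^ 2 * norm (h \<xi>)))" for \<xi> by simp
    qed
    also have "\<dots> = (norm v)\<^sup>2 * K2" unfolding K2_def by (rule integral_mult_right_zero)
    finally show ?thesis unfolding v_def .
  qed
  have "(fourier h has_derivative L) (at x)"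
  proof (rule has_derivativeI_sandwich[where e = 1 and H = "\<lambda>y. norm (y - x) * K2"])
    show "norm (fourier h y - fourier h x - L (y - x)) / norm (y - x) \<le> norm (y - x) * K2"
      if "y \<noteq> x" for y
    proof -
      have "norm (y - x) > 0" using that by simp
      with est[of y] show ?thesis by (subst pos_divide_le_eq) (auto simp: power2_eq_square mult_ac)
    qed
    have "((\<lambda>y. norm (y - x) * K2) \<longlongrightarrow> norm (x - x) * K2) (at x)"
      by (intro tendsto_intros)
    then show "((\<lambda>y. norm (y - x) * K2) \<longlongrightarrow> 0) (at x)" by simp
  qed (auto simp: bl)
  then show ?thesis by (simp only: L_def[abs_def])
qed

text \<open>The factor that the exponential of the Fourier integral releases when the transform is
  differentiated in the directions \<open>is\<close>; the sign is that of the forward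
  transform.\<close>

definition monom_symbol :: "'n::finite list \<Rightarrow> real^'n \<Rightarrow> complex" where
  "monom_symbol is \<xi> = (\<Prod>i\<leftarrow>is. - 2 * of_real pi * \<i> * complex_of_real (\<xi> $ i))"

lemma partial_deriv_fourier:
  "rapid h \<Longrightarrow> partial_deriv i (fourier h)
     = fourier (\<lambda>\<xi>. (- 2 * of_real pi * \<i>) * (complex_of_real (\<xi> $ i) * h \<xi>))"
proof
  fix x
  assume "rapid h"
  have "complex_of_real (axis i 1 \<bullet> \<xi>) = complex_of_real (\<xi> $ i)" for \<xi>
    by (simp add: inner_axis')
  with has_derivative_partial_deriv[OF has_derivative_fourier[OF \<open>rapid h\<close>], of i x]
  show "partial_deriv i (fourier h) x
     = fourier (\<lambda>\<xi>. (- 2 * of_real pi * \<i>) * (complex_of_real (\<xi> $ i) * h \<xi>)) x"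
    by (simp only:)
qed

lemma rapid_monom_symbol: "rapid h \<Longrightarrow> rapid (\<lambda>\<xi>. monom_symbol is \<xi> * h \<xi>)"
proof (induction "is")
  case (Cons i "is")
  have "(\<lambda>\<xi>. monom_symbol (i # is) \<xi> * h \<xi>)
    = (\<lambda>\<xi>. (- 2 * of_real pi * \<i>) * (complex_of_real (\<xi> $ i) * (monom_symbol is \<xi> * h \<xi>)))"
    by (simp add: monom_symbol_def mult.assoc)
  moreover have "rapid \<dots>" by (rule rapid_cmult[OF rapid_mult_coord[OF Cons.IH[OF Cons.prems]]])
  ultimately show ?case by (simp only:)
qed (simp add: monom_symbol_def)

lemma iter_deriv_fourier:
  assumes "rapid h"
  shows "iter_deriv is (fourier h) = fourier (\<lambda>\<xi>. monom_symbol is \<xi> * h \<xi>)"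
proof (induction "is")
  case (Cons i "is")
  then show ?case
    by (simp add: iter_deriv_Cons partial_deriv_fourier[OF rapid_monom_symbol[OF assms]])
       (simp add: monom_symbol_def mult.assoc)
qed (simp add: monom_symbol_def)

lemma smooth_fourier:
  assumes "rapid h"
  shows "smooth (fourier h)"
  unfolding smooth_def iter_deriv_fourier[OF assms] differentiable_on_def
proof (intro allI ballI)
  fix "is" and x :: "real^'a"
  show "fourier (\<lambda>\<xi>. monom_symbol is \<xi> * h \<xi>) differentiable at x within UNIV"
    by (rule differentiableI[OF has_derivative_fourier[OF rapid_monom_symbol[OF assms]]])
qed

section \<open>Fourier transforms of bump functions\<close>

text \<open>Compact support expressed as vanishing outside a ball: in this form it passes to
  derivatives, coordinate multiples and dilates without handling closures.\<close>

definition bump :: "(real^'n::finite \<Rightarrow> complex) \<Rightarrow> bool" where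
  "bump f \<longleftrightarrow> smooth f \<and> (\<exists>R. \<forall>x. norm x > R \<longrightarrow> f x = 0)"

lemma Cc_infty_bump: "f \<in> Cc_infty U \<Longrightarrow> bump f"
proof -
  assume "f \<in> Cc_infty U"
  then have f: "smooth f" and "bounded (supp f)"
    by (auto simp: Cc_infty_def intro: compact_imp_bounded)
  then obtain R where "\<And>x. x \<in> supp f \<Longrightarrow> norm x \<le> R"
    by (auto simp: bounded_iff)
  then have "f x = 0" if "norm x > R" for x
    using that closure_subset[of "{x. f x \<noteq> 0}"] unfolding supp_def by fastforce
  then show ?thesis using f unfolding bump_def by blast
qed

lemma bump_partial_deriv: "bump f \<Longrightarrow> bump (partial_deriv i f)"
proof -
  assume "bump f"
  then obtain R where f: "smooth f" and R: "\<And>x. norm x > R \<Longrightarrow> f x = 0"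
    by (auto simp: bump_def)
  have "partial_deriv i f x = 0" if x: "norm x > R" for x
  proof (rule has_derivative_partial_deriv)
    show "(f has_derivative (\<lambda>h. 0)) (at x)"
    proof (rule has_derivative_transform_within_open[of "\<lambda>x. 0"])
      show "open {x :: real^'a. norm x > R}" by (intro open_Collect_less continuous_intros)
    qed (use x R in auto)
  qed
  then show ?thesis using smooth_partial_deriv[OF f] unfolding bump_def by blast
qed

lemma bump_mult_coord: "bump f \<Longrightarrow> bump (\<lambda>x. complex_of_real (x $ i) * f x)"
  unfolding bump_def by (auto intro: smooth_mult smooth_coord)

lemma bump_cmult: "bump f \<Longrightarrow> bump (\<lambda>x. c * f x)"
  unfolding bump_def by (auto intro: smooth_mult smooth_const)

lemma bump_scale:
  assumes "bump f" "s > 0"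
  shows "bump (\<lambda>x. f (s *\<^sub>R x))"
proof -
  obtain R where R: "\<And>x. norm x > R \<Longrightarrow> f x = 0" using assms by (auto simp: bump_def)
  have "f (s *\<^sub>R x) = 0" if "norm x > R / s" for x
    using that assms(2) by (intro R) (simp add: field_simps)
  then show ?thesis using assms smooth_scale unfolding bump_def by blast
qed

lemma bump_bounded:
  assumes "bump f"
  obtains B where "B \<ge> 0" "\<And>x. norm (f x) \<le> B"
proof -
  obtain R where f: "smooth f" and R: "\<And>x. norm x > R \<Longrightarrow> f x = 0"
    using assms by (auto simp: bump_def)
  have "compact (f ` cball 0 R)"
    by (intro compact_continuous_image compact_cball continuous_on_subset[OF smooth_continuous[OF f]]) auto
  then obtain B where B: "\<And>x. norm x \<le> R \<Longrightarrow> norm (f x) \<le> B"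
    by (metis bounded_iff compact_imp_bounded image_eqI mem_cball_0)
  have "norm (f x) \<le> max B 0" for x
    using B[of x] R[of x] by (cases "norm x \<le> R") auto
  then show ?thesis by (intro that[of "max B 0"]) auto
qed

lemma bump_measurable: "bump f \<Longrightarrow> f \<in> borel_measurable borel"
  by (auto simp: bump_def intro: borel_measurable_continuous_onI smooth_continuous)

lemma bump_schwartz:
  assumes "bump f"
  shows "f \<in> schwartz"
proof (rule schwartzI)
  show "smooth f" using assms by (simp add: bump_def)
  fix k "is"
  have b: "bump (iter_deriv is f)"
    by (induction "is") (auto simp: iter_deriv_Cons assms intro: bump_partial_deriv)
  then obtain R where R: "\<And>x. norm x > R \<Longrightarrow> iter_deriv is f x = 0" by (auto simp: bump_def)
  obtain B where B: "B \<ge> 0" "\<And>x. norm (iter_deriv is f x) \<le> B"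
    using bump_bounded[OF b] by metis
  have "(1 + norm x) ^ k * norm (iter_deriv is f x) \<le> (1 + \<bar>R\<bar>) ^ k * B" for x
  proof (cases "norm x > R")
    case True
    then show ?thesis using R B(1) by simp
  next
    case False
    then show ?thesis using B by (intro mult_mono power_mono) auto
  qed
  then show "\<exists>C. \<forall>x. (1 + norm x) ^ k * norm (iter_deriv is f x) \<le> C" by blast
qed

lemma bump_rapid: "bump f \<Longrightarrow> rapid f"
  by (rule schwartz_rapid[OF bump_schwartz])

section \<open>Fourier transforms of derivatives, and the resulting decay\<close>

lemma has_vector_derivative_line:
  assumes "smooth f"
  shows "((\<lambda>t. f (x + t *\<^sub>R axis i 1)) has_vector_derivative partial_deriv i f (x + t *\<^sub>R axis i 1)) (at t within S)"
proof -
  let ?y = "x + t *\<^sub>R axis i 1"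
  have D: "(f has_derivative frechet_derivative f (at ?y)) (at ?y)"
    by (rule has_derivative_frechet_derivative[OF smooth_differentiable[OF assms]])
  have "((\<lambda>t. f (x + t *\<^sub>R axis i 1)) has_derivative (\<lambda>h. frechet_derivative f (at ?y) (h *\<^sub>R axis i 1))) (at t within S)"
    by (rule has_derivative_compose[where f = "\<lambda>t. x + t *\<^sub>R axis i 1" and g = f, OF _ D])
       (auto intro!: derivative_eq_intros)
  then show ?thesis
    by (simp add: has_vector_derivative_def partial_deriv_def
        linear_scale[OF has_derivative_linear[OF D]])
qed

lemma difference_quotient_bound:
  assumes "smooth f" and B: "\<And>x. norm (partial_deriv i f x) \<le> B"
  shows "norm (f (x + t *\<^sub>R axis i 1) - f x) \<le> B * \<bar>t\<bar>"
proof -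
  have "norm (f (x + t *\<^sub>R axis i 1) - f (x + 0 *\<^sub>R axis i 1)) \<le> B * norm (t - 0)"
  proof (rule differentiable_bound[where S = UNIV and f' = "\<lambda>t h. h *\<^sub>R partial_deriv i f (x + t *\<^sub>R axis i 1)"])
    fix s :: real
    show "((\<lambda>t. f (x + t *\<^sub>R axis i 1)) has_derivative (\<lambda>h. h *\<^sub>R partial_deriv i f (x + s *\<^sub>R axis i 1))) (at s within UNIV)"
      using has_vector_derivative_line[OF assms(1)] by (simp add: has_vector_derivative_def)
    show "onorm (\<lambda>h. h *\<^sub>R partial_deriv i f (x + s *\<^sub>R axis i 1)) \<le> B"
      by (rule onorm_le) (simp add: mult.commute[of B] mult_left_mono B)
  qed auto
  then show ?thesis by simp
qed

lemma integrable_lborel_translate: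
  fixes f :: "'a::euclidean_space \<Rightarrow> 'b::{banach, second_countable_topology}"
  assumes "integrable lborel f"
  shows "integrable lborel (\<lambda>x. f (a + x))"
proof -
  have "integrable (distr lborel borel ((+) a)) f"
    using assms by (simp only: lborel_distr_plus)
  then show ?thesis by (rule integrable_distr[rotated]) simp
qed

lemma fourier_translate:
  assumes "f \<in> borel_measurable borel"
  shows "fourier (\<lambda>\<xi>. f (\<xi> + a)) x = exp (2 * of_real pi * \<i> * of_real (a \<bullet> x)) * fourier f x"
proof -
  note [measurable] = assms
  have "fourier f x = (LINT \<xi>|lborel. exp (- 2 * of_real pi * \<i> * of_real ((a + \<xi>) \<bullet> x)) * f (a + \<xi>))"
    unfolding fourier_def by (rule integral_lborel_translate) measurable
  also have "\<dots> = (LINT \<xi>|lborel. exp (- 2 * of_real pi * \<i> * of_real (a \<bullet> x))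
      * (exp (- 2 * of_real pi * \<i> * of_real (\<xi> \<bullet> x)) * f (\<xi> + a)))"
    by (intro Bochner_Integration.integral_cong)
       (auto simp: inner_add_left distrib_left exp_add[symmetric] mult.assoc[symmetric] add.commute)
  also have "\<dots> = exp (- 2 * of_real pi * \<i> * of_real (a \<bullet> x)) * fourier (\<lambda>\<xi>. f (\<xi> + a)) x"
    by (simp add: fourier_def)
  finally show ?thesis by (simp add: mult.assoc[symmetric] exp_add[symmetric])
qed

lemma has_vector_derivative_quotient:
  assumes "(g has_vector_derivative D) (at 0)"
  shows "((\<lambda>s. (g s - g 0) /\<^sub>R s) \<longlongrightarrow> D) (at 0)"
proof -
  have lim: "((\<lambda>h. norm (g h - g 0 - h *\<^sub>R D) / norm h) \<longlongrightarrow> 0) (at 0)"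
    using assms unfolding has_vector_derivative_def has_derivative_at by simp
  have "norm (g h - g 0 - h *\<^sub>R D) / norm h = norm ((g h - g 0) /\<^sub>R h - D)" if "h \<noteq> 0" for h
  proof -
    have eq: "(g h - g 0) /\<^sub>R h - D = (g h - g 0 - h *\<^sub>R D) /\<^sub>R h"
      using that by (simp add: scaleR_right_diff_distrib)
    show ?thesis unfolding eq norm_scaleR by (simp add: divide_inverse)
  qed
  then have ev: "\<forall>\<^sub>F h in at 0. norm (g h - g 0 - h *\<^sub>R D) / norm h = norm ((g h - g 0) /\<^sub>R h - D)"
    unfolding eventually_at_filter by (intro always_eventually) blast
  have "((\<lambda>h. norm ((g h - g 0) /\<^sub>R h - D)) \<longlongrightarrow> 0) (at 0)"
    using lim unfolding tendsto_cong[OF ev] .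
  then show ?thesis by (rule LIM_zero_cancel[OF tendsto_norm_zero_cancel])
qed

text \<open>Difference quotients take the place of integration by parts. Their transforms converge
  to the transform of the partial derivative by dominated convergence; by the translation rule these
  transforms are also \<open>fourier f x\<close> times the difference quotient at 0 of an
  exponential. The two limits must agree.\<close>

lemma fourier_partial_deriv:
  fixes f :: "real^'n::finite \<Rightarrow> complex"
  assumes f: "bump f"
  shows "fourier (partial_deriv i f) x = (2 * of_real pi * \<i> * of_real (x $ i)) * fourier f x"
proof -
  have smooth: "smooth f" using f by (simp add: bump_def)
  obtain R where R: "\<And>x. norm x > R \<Longrightarrow> f x = 0" using f by (auto simp: bump_def)
  obtain B where B: "B \<ge> 0" "\<And>x. norm (partial_deriv i f x) \<le> B"
    using bump_bounded[OF bump_partial_deriv[OF f, of i]] by metis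
  note [measurable] = bump_measurable[OF f] bump_measurable[OF bump_partial_deriv[OF f]]
  define t where "t n = inverse (real (Suc n))" for n
  have t: "t n > 0" "t n \<le> 1" for n by (simp_all add: t_def divide_simps)
  have t0: "t \<longlonglongrightarrow> 0" unfolding t_def[abs_def] by (rule LIMSEQ_inverse_real_of_nat)
  have t0': "filterlim t (at 0) sequentially"
    using t0 t(1) by (auto simp: filterlim_at intro!: always_eventually) (metis less_irrefl t(1))
  let ?e = "\<lambda>\<xi>. exp (- 2 * of_real pi * \<i> * of_real (\<xi> \<bullet> x))"
  let ?q = "\<lambda>n \<xi>. ?e \<xi> * ((f (\<xi> + t n *\<^sub>R axis i 1) - f \<xi>) / of_real (t n))"
  have A: "(\<lambda>n. LINT \<xi>|lborel. ?q n \<xi>) \<longlonglongrightarrow> fourier (partial_deriv i f) x"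
    unfolding fourier_def
  proof (rule integral_dominated_convergence)
    \<comment> \<open>The step widths \<open>t n\<close> are at most 1, so the difference quotients
      vanish outside the ball of radius \<open>R + 1\<close>; inside it the mean value inequality
      bounds them by \<open>B\<close>.\<close>
    show "integrable lborel (\<lambda>\<xi>::real^'n. indicator (cball 0 (R + 1)) \<xi> *\<^sub>R B)"
      by (rule borel_integrable_compact) auto
    show "AE \<xi> in lborel. (\<lambda>n. ?q n \<xi>) \<longlonglongrightarrow> ?e \<xi> * partial_deriv i f \<xi>"
    proof (rule AE_I2)
      fix \<xi>
      have "((\<lambda>s. f (\<xi> + s *\<^sub>R axis i 1)) has_vector_derivative partial_deriv i f \<xi>) (at 0)"
        using has_vector_derivative_line[OF smooth, of \<xi> i 0 UNIV] by simp
      then have "((\<lambda>s. (f (\<xi> + s *\<^sub>R axis i 1) - f \<xi>) /\<^sub>R s) \<longlongrightarrow> partial_deriv i f \<xi>) (at 0)"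
        by (drule_tac has_vector_derivative_quotient) simp
      then show "(\<lambda>n. ?q n \<xi>) \<longlonglongrightarrow> ?e \<xi> * partial_deriv i f \<xi>"
        using filterlim_compose[OF _ t0', of "\<lambda>s. (f (\<xi> + s *\<^sub>R axis i 1) - f \<xi>) /\<^sub>R s"]
        by (intro tendsto_mult tendsto_const) (simp add: scaleR_conv_of_real divide_inverse mult.commute)
    qed
    show "AE \<xi> in lborel. norm (?q n \<xi>) \<le> indicator (cball 0 (R + 1)) \<xi> *\<^sub>R B" for n
    proof (rule AE_I2)
      fix \<xi> :: "real^'n"
      show "norm (?q n \<xi>) \<le> indicator (cball 0 (R + 1)) \<xi> *\<^sub>R B"
      proof (cases "norm \<xi> \<le> R + 1")
        case True
        then show ?thesis
          using difference_quotient_bound[OF smooth B(2), of \<xi> "t n"] t(1)[of n]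
          by (simp add: norm_mult norm_divide divide_le_eq)
      next
        case False
        have "norm \<xi> \<le> norm (\<xi> + t n *\<^sub>R axis i 1) + norm (t n *\<^sub>R axis i (1::real) :: real^'n)"
          using norm_triangle_ineq4[of "\<xi> + t n *\<^sub>R axis i (1::real)" "t n *\<^sub>R axis i (1::real)"] by simp
        also have "norm (t n *\<^sub>R axis i (1::real) :: real^'n) \<le> 1" using t[of n] by (simp add: norm_axis_1)
        finally have "norm (\<xi> + t n *\<^sub>R axis i 1) > R" using False by simp
        then show ?thesis using False R by simp
      qed
    qed
  qed measurable
  have "(LINT \<xi>|lborel. ?q n \<xi>)
      = (exp (2 * of_real pi * \<i> * of_real (t n * x $ i)) - 1) / of_real (t n) * fourier f x" for n
  proof -
    let ?a = "t n *\<^sub>R axis i 1"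
    have "?e \<xi> * f (\<xi> + ?a) = exp (2 * of_real pi * \<i> * of_real (?a \<bullet> x))
        * (exp (- 2 * of_real pi * \<i> * of_real ((?a + \<xi>) \<bullet> x)) * f (?a + \<xi>))" for \<xi>
      by (simp add: inner_add_left distrib_left exp_add[symmetric] mult.assoc[symmetric] add.commute)
    then have int: "integrable lborel (\<lambda>\<xi>. ?e \<xi> * f (\<xi> + ?a))"
      using integrable_lborel_translate[OF integrable_phase(1)[OF bump_rapid[OF f], of x], of ?a] by simp
    have "(LINT \<xi>|lborel. ?q n \<xi>)
        = (LINT \<xi>|lborel. (?e \<xi> * f (\<xi> + ?a) - ?e \<xi> * f \<xi>) / of_real (t n))"
      by (intro Bochner_Integration.integral_cong) (simp_all add: right_diff_distrib)
    also have "\<dots> = (fourier (\<lambda>\<xi>. f (\<xi> + ?a)) x - fourier f x) / of_real (t n)"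
      unfolding integral_divide_zero Bochner_Integration.integral_diff[OF int integrable_phase(1)[OF bump_rapid[OF f], of x]]
      by (simp only: fourier_def)
    also have "\<dots> = (exp (2 * of_real pi * \<i> * of_real (t n * x $ i)) - 1) / of_real (t n) * fourier f x"
      unfolding fourier_translate[OF bump_measurable[OF f]]
      by (simp add: left_diff_distrib inner_axis')
    finally show ?thesis .
  qed
  then have "(\<lambda>n. (exp (2 * of_real pi * \<i> * of_real (t n * x $ i)) - 1) / of_real (t n) * fourier f x)
      \<longlonglongrightarrow> fourier (partial_deriv i f) x"
    using A by (simp only:)
  moreover have "(\<lambda>n. (exp (2 * of_real pi * \<i> * of_real (t n * x $ i)) - 1) / of_real (t n) * fourier f x)
      \<longlonglongrightarrow> (2 * of_real pi * \<i> * of_real (x $ i)) * fourier f x"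
  proof (intro tendsto_mult tendsto_const)
    have "((\<lambda>s. exp (s *\<^sub>R (2 * of_real pi * \<i> * of_real (x $ i)))) has_vector_derivative
       2 * of_real pi * \<i> * of_real (x $ i)) (at 0)"
      using exp_scaleR_has_vector_derivative_right[of "2 * of_real pi * \<i> * of_real (x $ i)" 0 UNIV] by simp
    then have "((\<lambda>s. (exp (s *\<^sub>R (2 * of_real pi * \<i> * of_real (x $ i))) - 1) /\<^sub>R s) \<longlongrightarrow>
       2 * of_real pi * \<i> * of_real (x $ i)) (at 0)"
      by (drule_tac has_vector_derivative_quotient) simp
    from filterlim_compose[OF this t0']
    show "(\<lambda>n. (exp (2 * of_real pi * \<i> * of_real (t n * x $ i)) - 1) / of_real (t n))
      \<longlonglongrightarrow> 2 * of_real pi * \<i> * of_real (x $ i)"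
      by (simp add: scaleR_conv_of_real divide_inverse mult_ac)
  qed
  ultimately show ?thesis by (rule LIMSEQ_unique)
qed

text \<open>One power of the weight is traded for one derivative: |x| is at most the sum of the
  |x_i|, and |x_i| times the transform of f is, up to the factor 2 pi > 1, the transform of a
  partial derivative of f. That derivative is again a bump, so the induction hypothesis applies to
  it.\<close>

lemma fourier_decay:
  fixes f :: "real^'n::finite \<Rightarrow> complex"
  assumes "bump f"
  shows "\<exists>C\<ge>0. \<forall>x. (1 + norm x) ^ N * norm (fourier f x) \<le> C"
  using assms
proof (induction N arbitrary: f)
  case 0
  show ?case
    using fourier_norm_le[OF bump_rapid[OF 0]] by (intro exI[of _ "LINT \<xi>|lborel. norm (f \<xi>)"]) auto
next
  case (Suc N)
  obtain C where C: "C \<ge> 0" "\<And>x. (1 + norm x) ^ N * norm (fourier f x) \<le> C"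
    using Suc.IH[OF Suc.prems] by blast
  have "\<exists>D\<ge>0. \<forall>x. (1 + norm x) ^ N * norm (fourier (partial_deriv i f) x) \<le> D" for i
    by (rule Suc.IH[OF bump_partial_deriv[OF Suc.prems]])
  then obtain D where D: "\<And>i. D i \<ge> 0"
      "\<And>i x. (1 + norm x) ^ N * norm (fourier (partial_deriv i f) x) \<le> D i"
    by metis
  have "(1 + norm x) ^ Suc N * norm (fourier f x) \<le> C + (\<Sum>i\<in>UNIV. D i)" for x
  proof -
    let ?w = "(1 + norm x) ^ N"
    have comp: "\<bar>x $ i\<bar> * (?w * norm (fourier f x)) \<le> D i" for i
    proof -
      have "1 * (\<bar>x $ i\<bar> * (?w * norm (fourier f x))) \<le> (2 * pi) * (\<bar>x $ i\<bar> * (?w * norm (fourier f x)))"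
        using pi_gt3 by (intro mult_right_mono) auto
      also have "\<dots> = ?w * norm (fourier (partial_deriv i f) x)"
        by (simp add: fourier_partial_deriv[OF Suc.prems] norm_mult)
      also have "\<dots> \<le> D i" by (rule D)
      finally show ?thesis by simp
    qed
    have "(1 + norm x) ^ Suc N * norm (fourier f x)
        = ?w * norm (fourier f x) + norm x * (?w * norm (fourier f x))"
      by (simp add: algebra_simps)
    also have "\<dots> \<le> C + (\<Sum>i\<in>UNIV. \<bar>x $ i\<bar>) * (?w * norm (fourier f x))"
      by (intro add_mono C mult_right_mono norm_le_l1_cart) auto
    also have "\<dots> \<le> C + (\<Sum>i\<in>UNIV. D i)"
      unfolding sum_distrib_right by (intro add_left_mono sum_mono comp)
    finally show ?thesis .
  qed
  moreover have "C + (\<Sum>i\<in>UNIV. D i) \<ge> 0" using C(1) D(1) by (simp add: sum_nonneg)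
  ultimately show ?case by blast
qed

text \<open>Writing one factor y . xi in coordinates pulls y out of the integral and leaves xi_i on
  the function, which stays rapid, or a bump. This is the induction step both for the decay uniform
  in y and for the polynomial dependence on y.\<close>

lemma fourier_power_inner_Suc:
  fixes f :: "real^'n::finite \<Rightarrow> complex"
  assumes "rapid f"
  shows "fourier (\<lambda>\<xi>. complex_of_real (y \<bullet> \<xi>) ^ Suc m * f \<xi>) z
    = (\<Sum>i\<in>UNIV. of_real (y $ i) * fourier (\<lambda>\<xi>. complex_of_real (y \<bullet> \<xi>) ^ m * (complex_of_real (\<xi> $ i) * f \<xi>)) z)"
proof -
  have "(\<lambda>\<xi>. complex_of_real (y \<bullet> \<xi>) ^ Suc m * f \<xi>)
    = (\<lambda>\<xi>. \<Sum>i\<in>UNIV. of_real (y $ i) * (complex_of_real (y \<bullet> \<xi>) ^ m * (complex_of_real (\<xi> $ i) * f \<xi>)))"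
  proof
    fix \<xi>
    have y: "complex_of_real (y \<bullet> \<xi>) = (\<Sum>i\<in>UNIV. of_real (y $ i) * of_real (\<xi> $ i))"
      by (simp add: inner_vec_def)
    have "complex_of_real (y \<bullet> \<xi>) ^ Suc m * f \<xi>
      = (\<Sum>i\<in>UNIV. of_real (y $ i) * of_real (\<xi> $ i)) * (complex_of_real (y \<bullet> \<xi>) ^ m * f \<xi>)"
      by (simp only: y[symmetric] power_Suc mult.assoc)
    also have "\<dots> = (\<Sum>i\<in>UNIV. of_real (y $ i) * (complex_of_real (y \<bullet> \<xi>) ^ m * (complex_of_real (\<xi> $ i) * f \<xi>)))"
      unfolding sum_distrib_right by (intro sum.cong) (simp_all add: mult_ac)
    finally show "complex_of_real (y \<bullet> \<xi>) ^ Suc m * f \<xi>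
      = (\<Sum>i\<in>UNIV. of_real (y $ i) * (complex_of_real (y \<bullet> \<xi>) ^ m * (complex_of_real (\<xi> $ i) * f \<xi>)))" .
  qed
  moreover have "fourier \<dots> z = (\<Sum>i\<in>UNIV. fourier (\<lambda>\<xi>. of_real (y $ i) * (complex_of_real (y \<bullet> \<xi>) ^ m * (complex_of_real (\<xi> $ i) * f \<xi>))) z)"
    by (intro fourier_sum rapid_cmult rapid_power_inner rapid_mult_coord assms)
  ultimately show ?thesis by (simp add: fourier_cmult)
qed

text \<open>The bound serves the Taylor remainder of order m in direction y. The constant must be
  independent of y, because y is the variable in which the remainder is later integrated against the
  test function.\<close>

lemma fourier_power_inner_decay:
  fixes f :: "real^'n::finite \<Rightarrow> complex"
  assumes "bump f"
  shows "\<exists>C\<ge>0. \<forall>y z. (1 + norm z) ^ N * norm (fourier (\<lambda>\<xi>. complex_of_real (y \<bullet> \<xi>) ^ m * f \<xi>) z) \<le> C * norm y ^ m"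
  using assms
proof (induction m arbitrary: f)
  case 0
  then show ?case using fourier_decay[of f N] by auto
next
  case (Suc m)
  have "\<forall>i. \<exists>C. C \<ge> 0 \<and> (\<forall>y z. (1 + norm z) ^ N *
      norm (fourier (\<lambda>\<xi>. complex_of_real (y \<bullet> \<xi>) ^ m * (complex_of_real (\<xi> $ i) * f \<xi>)) z) \<le> C * norm y ^ m)"
    using Suc.IH[OF bump_mult_coord[OF Suc.prems]] by blast
  then obtain C where C: "\<And>i. C i \<ge> 0" "\<And>i y z. (1 + norm z) ^ N *
      norm (fourier (\<lambda>\<xi>. complex_of_real (y \<bullet> \<xi>) ^ m * (complex_of_real (\<xi> $ i) * f \<xi>)) z) \<le> C i * norm y ^ m"
    unfolding choice_iff by blast
  have "(1 + norm z) ^ N * norm (fourier (\<lambda>\<xi>. complex_of_real (y \<bullet> \<xi>) ^ Suc m * f \<xi>) z)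
      \<le> (\<Sum>i\<in>UNIV. C i) * norm y ^ Suc m" for y z
  proof -
    let ?F = "\<lambda>i. fourier (\<lambda>\<xi>. complex_of_real (y \<bullet> \<xi>) ^ m * (complex_of_real (\<xi> $ i) * f \<xi>)) z"
    have "(1 + norm z) ^ N * norm (fourier (\<lambda>\<xi>. complex_of_real (y \<bullet> \<xi>) ^ Suc m * f \<xi>) z)
      \<le> (1 + norm z) ^ N * (\<Sum>i\<in>UNIV. norm (of_real (y $ i) * ?F i))"
      unfolding fourier_power_inner_Suc[OF bump_rapid[OF Suc.prems]]
      by (intro mult_left_mono norm_sum) auto
    also have "\<dots> = (\<Sum>i\<in>UNIV. \<bar>y $ i\<bar> * ((1 + norm z) ^ N * norm (?F i)))"
      by (simp add: sum_distrib_left norm_mult mult_ac)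
    also have "\<dots> \<le> (\<Sum>i\<in>UNIV. norm y * (C i * norm y ^ m))"
      by (intro sum_mono mult_mono component_le_norm_cart C) auto
    also have "\<dots> = (\<Sum>i\<in>UNIV. C i) * norm y ^ Suc m"
      unfolding sum_distrib_right by (simp only: power_Suc mult.left_commute)
    finally show ?thesis .
  qed
  moreover have "(\<Sum>i\<in>UNIV. C i) \<ge> 0" using C(1) by (simp add: sum_nonneg)
  ultimately show ?case by blast
qed

text \<open>Up to constants these are the Taylor terms of the kernel in the displacement y. Being
  polynomials in y, they are annihilated by a test function whose moments vanish.\<close>

lemma polynomial_fourier_power_inner:
  fixes f :: "real^'n::finite \<Rightarrow> complex"
  assumes "rapid f"
  shows "polynomial_function (\<lambda>y. fourier (\<lambda>\<xi>. complex_of_real (y \<bullet> \<xi>) ^ m * f \<xi>) z)"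
  using assms
proof (induction m arbitrary: f)
  case (Suc m)
  let ?F = "\<lambda>i y. fourier (\<lambda>\<xi>. complex_of_real (y \<bullet> \<xi>) ^ m * (complex_of_real (\<xi> $ i) * f \<xi>)) z"
  have "polynomial_function (\<lambda>y::real^'n. \<Sum>i\<in>UNIV. (y $ i) *\<^sub>R ?F i y)"
    by (intro polynomial_function_sum polynomial_function_mult Suc.IH rapid_mult_coord Suc.prems
        polynomial_function_bounded_linear bounded_linear_vec_nth) auto
  then show ?case
    by (simp only: fourier_power_inner_Suc[OF Suc.prems] scaleR_conv_of_real)
qed simp

text \<open>One-dimensional Taylor formula with integral remainder along the segment from x to x -
  y. Decay of the m-th derivative at the intermediate points is turned into decay in x, which costs
  the factor (1 + |y|)^N.\<close>

lemma fourier_taylor: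
  fixes f :: "real^'n::finite \<Rightarrow> complex"
  assumes f: "bump f" and m: "m > 0"
  shows "\<exists>C\<ge>0. \<forall>x y. (1 + norm x) ^ N *
     norm (fourier f (x - y) - (\<Sum>l<m. (2 * of_real pi * \<i>) ^ l / fact l * fourier (\<lambda>\<xi>. complex_of_real (y \<bullet> \<xi>) ^ l * f \<xi>) x))
     \<le> C * (norm y ^ m * (1 + norm y) ^ N)"
proof -
  let ?c = "2 * of_real pi * \<i>"
  obtain C where C: "C \<ge> 0" "\<And>y z. (1 + norm z) ^ N *
      norm (fourier (\<lambda>\<xi>. complex_of_real (y \<bullet> \<xi>) ^ m * f \<xi>) z) \<le> C * norm y ^ m"
    using fourier_power_inner_decay[OF f] by blast
  note rf = bump_rapid[OF f]
  have "(1 + norm x) ^ N *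
     norm (fourier f (x - y) - (\<Sum>l<m. ?c ^ l / fact l * fourier (\<lambda>\<xi>. complex_of_real (y \<bullet> \<xi>) ^ l * f \<xi>) x))
     \<le> ((2 * pi) ^ m * C) * (norm y ^ m * (1 + norm y) ^ N)" for x y
  proof -
    \<comment> \<open>The l-th derivative along the segment. The minus signs of the Fourier exponent
      and of x - t y cancel, which leaves powers of + 2 pi i.\<close>
    define Df where "Df l t = ?c ^ l * fourier (\<lambda>\<xi>. complex_of_real (y \<bullet> \<xi>) ^ l * f \<xi>) (x - t *\<^sub>R y)" for l t
    have Df: "(Df l has_vector_derivative Df (Suc l) t) (at t within S)" for l t S
    proof -
      let ?g = "\<lambda>\<xi>. complex_of_real (y \<bullet> \<xi>) ^ l * f \<xi>"
      let ?L = "\<lambda>v. fourier (\<lambda>\<xi>. (- ?c) * (complex_of_real (v \<bullet> \<xi>) * ?g \<xi>)) (x - t *\<^sub>R y)"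
      have L: "?L v = (- ?c) * fourier (\<lambda>\<xi>. complex_of_real (v \<bullet> \<xi>) * ?g \<xi>) (x - t *\<^sub>R y)" for v
        by (rule fourier_cmult)
      have D: "(fourier ?g has_derivative ?L) (at (x - t *\<^sub>R y))"
        using has_derivative_fourier[OF rapid_power_inner[OF rf], of y l "x - t *\<^sub>R y"] by simp
      have "((\<lambda>t. fourier ?g (x - t *\<^sub>R y)) has_derivative (\<lambda>h. ?L (- (h *\<^sub>R y)))) (at t within S)"
        by (rule has_derivative_compose[where f = "\<lambda>t. x - t *\<^sub>R y" and g = "fourier ?g", OF _ D])
           (auto intro!: derivative_eq_intros)
      moreover have "?L (- (h *\<^sub>R y)) = h *\<^sub>R (?c * fourier (\<lambda>\<xi>. complex_of_real (y \<bullet> \<xi>) ^ Suc l * f \<xi>) (x - t *\<^sub>R y))" for h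
        unfolding L
        using fourier_cmult[of "- of_real h" "\<lambda>\<xi>. complex_of_real (y \<bullet> \<xi>) * ?g \<xi>" "x - t *\<^sub>R y"]
        by (simp add: scaleR_conv_of_real[where 'a = complex] mult.assoc mult.left_commute)
      ultimately have "((\<lambda>t. fourier ?g (x - t *\<^sub>R y)) has_vector_derivative
          ?c * fourier (\<lambda>\<xi>. complex_of_real (y \<bullet> \<xi>) ^ Suc l * f \<xi>) (x - t *\<^sub>R y)) (at t within S)"
        by (simp add: has_vector_derivative_def)
      from has_vector_derivative_mult_right[OF this, of "?c ^ l"]
      show ?thesis unfolding Df_def[abs_def] by (simp add: mult.assoc mult.left_commute)
    qed
    have "((\<lambda>t. ((1 - t) ^ (m - 1) / fact (m - 1)) *\<^sub>R Df m t) has_integral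
        Df 0 1 - (\<Sum>l<m. ((1 - 0) ^ l / fact l) *\<^sub>R Df l 0)) {0..1}"
      by (rule Taylor_has_integral[where Df = Df and f = "Df 0" and p = m and a = 0 and b = 1, OF m refl]) (auto intro: Df)
    moreover have "Df 0 1 - (\<Sum>l<m. ((1 - 0) ^ l / fact l) *\<^sub>R Df l 0)
       = fourier f (x - y) - (\<Sum>l<m. ?c ^ l / fact l * fourier (\<lambda>\<xi>. complex_of_real (y \<bullet> \<xi>) ^ l * f \<xi>) x)"
    proof (intro arg_cong2[where f = minus] sum.cong refl)
      show "Df 0 1 = fourier f (x - y)" by (simp add: Df_def)
      show "((1 - 0) ^ l / fact l) *\<^sub>R Df l 0
          = ?c ^ l / fact l * fourier (\<lambda>\<xi>. complex_of_real (y \<bullet> \<xi>) ^ l * f \<xi>) x" for l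
        by (simp add: Df_def scaleR_conv_of_real[where 'a = complex])
    qed
    ultimately have I: "((\<lambda>t. ((1 - t) ^ (m - 1) / fact (m - 1)) *\<^sub>R Df m t) has_integral
       fourier f (x - y) - (\<Sum>l<m. ?c ^ l / fact l * fourier (\<lambda>\<xi>. complex_of_real (y \<bullet> \<xi>) ^ l * f \<xi>) x)) (cbox 0 1)"
      by simp
    let ?B = "((2 * pi) ^ m * C) * (norm y ^ m * (1 + norm y) ^ N)"
    have w: "(1 + norm x) ^ N > 0" by (intro zero_less_power add_pos_nonneg) auto
    have "norm (((1 - t) ^ (m - 1) / fact (m - 1)) *\<^sub>R Df m t) \<le> ?B / (1 + norm x) ^ N"
      if t: "t \<in> cbox 0 (1::real)" for t
    proof -
      let ?z = "x - t *\<^sub>R y"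
      let ?F = "norm (fourier (\<lambda>\<xi>. complex_of_real (y \<bullet> \<xi>) ^ m * f \<xi>) ?z)"
      have "(1 - t) ^ (m - 1) \<le> fact (m - 1)"
        by (rule order_trans[OF power_le_one fact_ge_1]) (use t in auto)
      then have "(1 - t) ^ (m - 1) / fact (m - 1) \<le> 1"
        by (subst pos_divide_le_eq) auto
      then have "norm (((1 - t) ^ (m - 1) / fact (m - 1)) *\<^sub>R Df m t) \<le> norm (Df m t)"
        unfolding norm_scaleR using t by (intro mult_left_le_one_le) auto
      also have "\<dots> = (2 * pi) ^ m * ?F" by (simp add: Df_def norm_mult norm_power)
      finally have 1: "norm (((1 - t) ^ (m - 1) / fact (m - 1)) *\<^sub>R Df m t) \<le> (2 * pi) ^ m * ?F" .
      \<comment> \<open>A Peetre-type inequality: it moves the weight from the base point x to the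
        intermediate point, where the decay of the transform is available.\<close>
      have "norm x \<le> norm ?z + t * norm y"
        using norm_triangle_ineq[of ?z "t *\<^sub>R y"] t by simp
      moreover have "t * norm y \<le> norm y" using t by (simp add: mult_left_le_one_le)
      ultimately have "1 + norm x \<le> (1 + norm ?z) * (1 + norm y)"
        unfolding distrib_left distrib_right mult_1 mult_1_right
        using mult_nonneg_nonneg[OF norm_ge_zero[of ?z] norm_ge_zero[of y]] by linarith
      then have "(1 + norm x) ^ N \<le> (1 + norm ?z) ^ N * (1 + norm y) ^ N"
        unfolding power_mult_distrib[symmetric] by (intro power_mono) auto
      then have "(1 + norm x) ^ N * ((2 * pi) ^ m * ?F)
          \<le> (1 + norm ?z) ^ N * (1 + norm y) ^ N * ((2 * pi) ^ m * ?F)"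
        by (intro mult_right_mono) auto
      also have "\<dots> = ((2 * pi) ^ m * (1 + norm y) ^ N) * ((1 + norm ?z) ^ N * ?F)"
        by (simp add: mult_ac)
      also have "\<dots> \<le> ((2 * pi) ^ m * (1 + norm y) ^ N) * (C * norm y ^ m)"
        by (intro mult_left_mono C) auto
      finally have "(2 * pi) ^ m * ?F \<le> ?B / (1 + norm x) ^ N"
        using w by (simp add: pos_le_divide_eq mult_ac)
      with 1 show ?thesis by (rule order_trans)
    qed
    then have "norm (fourier f (x - y) - (\<Sum>l<m. ?c ^ l / fact l * fourier (\<lambda>\<xi>. complex_of_real (y \<bullet> \<xi>) ^ l * f \<xi>) x))
        \<le> ?B / (1 + norm x) ^ N * measure lborel (cbox 0 (1::real))"
      using C(1) w by (intro has_integral_bound[OF _ I]) auto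
    then show ?thesis using w by (simp add: pos_le_divide_eq mult_ac)
  qed
  moreover have "(2 * pi) ^ m * C \<ge> 0" using C(1) by simp
  ultimately show ?thesis by blast
qed

section \<open>Low-frequency cutoffs\<close>

text \<open>Fubini for the double integral in xi and y: for fixed y the two exponentials combine
  into the Fourier kernel at x - y. It exhibits a frequency cutoff as convolution with the transform
  of its symbol.\<close>

lemma fourier_mult_inv_fourier:
  fixes g h :: "real^'n::finite \<Rightarrow> complex"
  assumes g: "rapid g" and h: "rapid h"
  shows "fourier (\<lambda>\<xi>. g \<xi> * inv_fourier h \<xi>) x = (LINT y|lborel. h y * fourier g (x - y))"
proof -
  note [measurable] = rapid_measurable[OF g] rapid_measurable[OF h]
  let ?e = "\<lambda>\<xi>::real^'n. exp (- 2 * of_real pi * \<i> * of_real (\<xi> \<bullet> x))"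
  let ?E = "\<lambda>\<xi> y::real^'n. exp (2 * of_real pi * \<i> * of_real (\<xi> \<bullet> y))"
  let ?F = "\<lambda>\<xi> y. ?e \<xi> * g \<xi> * (?E y \<xi> * h y)"
  have meas [measurable]: "case_prod ?F \<in> borel_measurable (lborel \<Otimes>\<^sub>M lborel)"
    by measurable
  have int: "integrable (lborel \<Otimes>\<^sub>M lborel) (case_prod ?F)"
  proof (rule lborel_pair.Fubini_integrable[OF meas])
    have "(\<lambda>\<xi>. LINT y|lborel. norm (case_prod ?F (\<xi>, y))) = (\<lambda>\<xi>. norm (g \<xi>) * (LINT y|lborel. norm (h y)))"
      by (simp add: norm_mult)
    then show "integrable lborel (\<lambda>\<xi>. LINT y|lborel. norm (case_prod ?F (\<xi>, y)))"
      using rapid_integrable[OF g] by simp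
    show "AE \<xi> in lborel. integrable lborel (\<lambda>y. case_prod ?F (\<xi>, y))"
      using integrable_phase(2)[OF h] by (simp add: inner_commute)
  qed
  have "fourier (\<lambda>\<xi>. g \<xi> * inv_fourier h \<xi>) x = (LINT \<xi>|lborel. LINT y|lborel. ?F \<xi> y)"
    unfolding fourier_def inv_fourier_def
    by (simp add: mult.assoc inner_commute)
  also have "\<dots> = (LINT y|lborel. LINT \<xi>|lborel. ?F \<xi> y)"
    by (rule lborel_pair.Fubini_integral[OF int, symmetric])
  also have "\<dots> = (LINT y|lborel. h y * fourier g (x - y))"
  proof (rule Bochner_Integration.integral_cong[OF refl])
    fix y
    have "?F \<xi> y = h y * (exp (- 2 * of_real pi * \<i> * of_real (\<xi> \<bullet> (x - y))) * g \<xi>)" for \<xi>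
    proof -
      have "?e \<xi> * ?E y \<xi> = exp (- 2 * of_real pi * \<i> * of_real (\<xi> \<bullet> (x - y)))"
        by (simp add: exp_add[symmetric] inner_diff_right right_diff_distrib inner_commute)
      moreover have "?F \<xi> y = h y * (?e \<xi> * ?E y \<xi> * g \<xi>)" by (simp only: mult_ac)
      ultimately show ?thesis by (simp only:)
    qed
    then show "(LINT \<xi>|lborel. ?F \<xi> y) = h y * fourier g (x - y)"
      by (simp only: fourier_def integral_mult_right_zero)
  qed
  finally show ?thesis .
qed

lemma fourier_scale:
  fixes f :: "real^'n::finite \<Rightarrow> complex"
  assumes [measurable]: "f \<in> borel_measurable borel" and r: "r > 0"
  shows "fourier (\<lambda>\<xi>. f (inverse r *\<^sub>R \<xi>)) z = of_real (r ^ CARD('n)) * fourier f (r *\<^sub>R z)"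
proof -
  have "fourier (\<lambda>\<xi>. f (inverse r *\<^sub>R \<xi>)) z = (r ^ DIM(real^'n)) *\<^sub>R
    (LINT \<xi>|lborel. exp (- 2 * of_real pi * \<i> * of_real ((r *\<^sub>R \<xi>) \<bullet> z)) * f (inverse r *\<^sub>R (r *\<^sub>R \<xi>)))"
    unfolding fourier_def using r by (intro integral_lborel_scale) measurable
  then show ?thesis using r by (simp add: fourier_def scaleR_conv_of_real[where 'a = complex])
qed

text \<open>By Fubini the left-hand side is, up to the weight, the integral of \<open>h y\<close> against
  \<open>r\<^sup>n \<theta> (r x - r y)\<close>, where \<open>\<theta>\<close> is the Fourier transform of \<open>w\<close>. As \<open>h\<close> annihilates
  polynomials, the Taylor polynomial of \<open>\<theta>\<close> at \<open>r x\<close> drops out; each Taylor order gains a factor \<open>r\<close>,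
  while the weight costs only \<open>r\<^sup>-\<^sup>N\<close>.\<close>

lemma fourier_low_frequency_bound:
  fixes w h :: "real^'n::finite \<Rightarrow> complex"
  assumes w: "bump w" and h: "rapid h"
    and ann: "\<And>P. polynomial_function P \<Longrightarrow> (LINT y|lborel. P y * h y) = 0"
  shows "\<exists>C\<ge>0. \<forall>r x. 0 < r \<longrightarrow> r \<le> 1 \<longrightarrow>
     (1 + norm x) ^ N * norm (fourier (\<lambda>\<xi>. w (inverse r *\<^sub>R \<xi>) * inv_fourier h \<xi>) x) \<le> C * r"
proof -
  note [measurable] = rapid_measurable[OF h]
  \<comment> \<open>N of the m powers of r pay for replacing the weight in x by the weight in r x;
    the remaining one is the rate of decay.\<close>
  define m where "m = Suc N"
  define T where "T x y = (\<Sum>l<m. (2 * of_real pi * \<i>) ^ l / fact l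
      * fourier (\<lambda>\<xi>. complex_of_real (y \<bullet> \<xi>) ^ l * w \<xi>) x)" for x y
  obtain C where C: "C \<ge> 0" "\<And>x y. (1 + norm x) ^ N * norm (fourier w (x - y) - T x y)
      \<le> C * (norm y ^ m * (1 + norm y) ^ N)"
    using fourier_taylor[OF w, of m N] unfolding T_def m_def by blast
  have cmult: "polynomial_function (\<lambda>y. c * p y)" if "polynomial_function p" for c and p :: "real^'n \<Rightarrow> complex"
    using polynomial_function_compose[OF that polynomial_function_bounded_linear[OF bounded_linear_mult_right[of c]]]
    by (simp add: o_def)
  have T_poly': "polynomial_function (T z)" for z
    unfolding T_def by (intro polynomial_function_sum cmult polynomial_fourier_power_inner bump_rapid w) auto
  define K where "K = (LINT y|lborel. (1 + norm y) ^ (m + N) * norm (h y))"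
  have K: "K \<ge> 0" unfolding K_def by (rule integral_nonneg_AE) auto
  have "(1 + norm x) ^ N * norm (fourier (\<lambda>\<xi>. w (inverse r *\<^sub>R \<xi>) * inv_fourier h \<xi>) x) \<le> (C * K) * r"
    if r: "0 < r" "r \<le> 1" for r x
  proof -
    have wr: "rapid (\<lambda>\<xi>. w (inverse r *\<^sub>R \<xi>))"
      using r by (intro bump_rapid bump_scale w) auto
    have T_poly: "polynomial_function (\<lambda>y. T (r *\<^sub>R x) (r *\<^sub>R y))"
      using polynomial_function_compose[OF polynomial_function_bounded_linear[OF bounded_linear_scaleR_right[of r]] T_poly']
      by (simp add: o_def)
    note [measurable] =
      borel_measurable_continuous_onI[OF continuous_on_polymonial_function[OF T_poly]]
    define B where "B = (LINT \<xi>|lborel. norm (w \<xi>))"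
    have B: "norm (fourier w z) \<le> B" for z
      unfolding B_def by (rule fourier_norm_le[OF bump_rapid[OF w]])
    have W_int: "integrable lborel (\<lambda>y. fourier w (r *\<^sub>R x - r *\<^sub>R y) * h y)"
    proof (rule rapid_integrable[OF rapid_mult[where C = B and k = 0, OF h]])
      show "(\<lambda>y. fourier w (r *\<^sub>R x - r *\<^sub>R y)) \<in> borel_measurable borel"
        by (intro borel_measurable_continuous_onI
            continuous_on_compose2[OF smooth_continuous[OF smooth_fourier[OF bump_rapid[OF w]]]] continuous_intros) auto
    qed (use B in simp)
    have pt: "(1 + norm x) ^ N * norm (fourier w (r *\<^sub>R x - r *\<^sub>R y) - T (r *\<^sub>R x) (r *\<^sub>R y))
        \<le> C * r * (1 + norm y) ^ (m + N)" for y
    proof -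
      let ?D = "norm (fourier w (r *\<^sub>R x - r *\<^sub>R y) - T (r *\<^sub>R x) (r *\<^sub>R y))"
      have "r * (1 + norm x) \<le> 1 + norm (r *\<^sub>R x)" using r by (simp add: distrib_left)
      then have "r ^ N * (1 + norm x) ^ N \<le> (1 + norm (r *\<^sub>R x)) ^ N"
        unfolding power_mult_distrib[symmetric] using r by (intro power_mono) auto
      then have "r ^ N * (1 + norm x) ^ N * ?D \<le> (1 + norm (r *\<^sub>R x)) ^ N * ?D"
        by (rule mult_right_mono) simp
      also have "\<dots> \<le> C * (norm (r *\<^sub>R y) ^ m * (1 + norm (r *\<^sub>R y)) ^ N)"
        by (rule C(2))
      also have "\<dots> \<le> C * ((r ^ m * (1 + norm y) ^ m) * (1 + norm y) ^ N)"
      proof (intro mult_left_mono mult_mono power_mono C(1))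
        show "norm (r *\<^sub>R y) ^ m \<le> r ^ m * (1 + norm y) ^ m"
          unfolding power_mult_distrib[symmetric] using r by (intro power_mono) auto
        show "1 + norm (r *\<^sub>R y) \<le> 1 + norm y" using r by (simp add: mult_left_le_one_le)
      qed (use r in auto)
      also have "\<dots> = r ^ N * (C * r * (1 + norm y) ^ (m + N))"
        by (simp add: m_def power_add mult_ac)
      finally have "r ^ N * ((1 + norm x) ^ N * ?D) \<le> r ^ N * (C * r * (1 + norm y) ^ (m + N))"
        by (simp only: mult.assoc)
      moreover have "r ^ N > 0" using r by simp
      ultimately show ?thesis by (rule mult_left_le_imp_le)
    qed
    \<comment> \<open>Integrability of the polynomial part is read off from the remainder estimate:
      \<open>T\<close> differs from the bounded function \<open>fourier w\<close> by a term of
      polynomial growth in y.\<close>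
    have T_int: "integrable lborel (\<lambda>y. T (r *\<^sub>R x) (r *\<^sub>R y) * h y)"
    proof (rule rapid_integrable[OF rapid_mult[where C = "B + C" and k = "m + N", OF h]])
      show "norm (T (r *\<^sub>R x) (r *\<^sub>R y)) \<le> (B + C) * (1 + norm y) ^ (m + N)" for y
      proof -
        let ?D = "norm (fourier w (r *\<^sub>R x - r *\<^sub>R y) - T (r *\<^sub>R x) (r *\<^sub>R y))"
        have "1 * ?D \<le> (1 + norm x) ^ N * ?D" by (intro mult_right_mono one_le_power) auto
        also have "\<dots> \<le> C * r * (1 + norm y) ^ (m + N)" by (rule pt)
        also have "\<dots> \<le> C * (1 + norm y) ^ (m + N)"
          using r C(1) by (intro mult_right_mono mult_right_le_one_le) auto
        finally have "?D \<le> C * (1 + norm y) ^ (m + N)" by simp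
        moreover have "B * 1 \<le> B * (1 + norm y) ^ (m + N)"
          using order_trans[OF norm_ge_zero B] by (intro mult_left_mono one_le_power) auto
        ultimately show ?thesis
          using norm_triangle_ineq4[of "fourier w (r *\<^sub>R x - r *\<^sub>R y)" "fourier w (r *\<^sub>R x - r *\<^sub>R y) - T (r *\<^sub>R x) (r *\<^sub>R y)"]
            B[of "r *\<^sub>R x - r *\<^sub>R y"] by (simp add: distrib_right)
      qed
    qed measurable
    have "fourier (\<lambda>\<xi>. w (inverse r *\<^sub>R \<xi>) * inv_fourier h \<xi>) x
        = (LINT y|lborel. h y * (of_real (r ^ CARD('n)) * fourier w (r *\<^sub>R (x - y))))"
      unfolding fourier_mult_inv_fourier[OF wr h] fourier_scale[OF bump_measurable[OF w] r(1)] ..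
    also have "\<dots> = of_real (r ^ CARD('n)) * (LINT y|lborel. fourier w (r *\<^sub>R x - r *\<^sub>R y) * h y)"
      unfolding integral_mult_right_zero[symmetric] scaleR_right_diff_distrib by (simp only: mult_ac)
    also have "(LINT y|lborel. fourier w (r *\<^sub>R x - r *\<^sub>R y) * h y)
        = (LINT y|lborel. (fourier w (r *\<^sub>R x - r *\<^sub>R y) - T (r *\<^sub>R x) (r *\<^sub>R y)) * h y)"
      using Bochner_Integration.integral_diff[OF W_int T_int] ann[OF T_poly]
      by (simp add: left_diff_distrib)
    finally have eq: "fourier (\<lambda>\<xi>. w (inverse r *\<^sub>R \<xi>) * inv_fourier h \<xi>) x = of_real (r ^ CARD('n)) *
      (LINT y|lborel. (fourier w (r *\<^sub>R x - r *\<^sub>R y) - T (r *\<^sub>R x) (r *\<^sub>R y)) * h y)" .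
    \<comment> \<open>The Jacobian r^n of the dilated kernel is at most 1 and is dropped.\<close>
    have "(1 + norm x) ^ N * norm (fourier (\<lambda>\<xi>. w (inverse r *\<^sub>R \<xi>) * inv_fourier h \<xi>) x)
      \<le> (1 + norm x) ^ N * norm (LINT y|lborel. (fourier w (r *\<^sub>R x - r *\<^sub>R y) - T (r *\<^sub>R x) (r *\<^sub>R y)) * h y)"
      unfolding eq norm_mult using r
      by (intro mult_left_mono mult_left_le_one_le) (auto simp: norm_power power_le_one)
    also have "\<dots> \<le> (1 + norm x) ^ N * (LINT y|lborel. norm ((fourier w (r *\<^sub>R x - r *\<^sub>R y) - T (r *\<^sub>R x) (r *\<^sub>R y)) * h y))"
      by (intro mult_left_mono integral_norm_bound) auto
    also have "\<dots> = (LINT y|lborel. (1 + norm x) ^ N * norm ((fourier w (r *\<^sub>R x - r *\<^sub>R y) - T (r *\<^sub>R x) (r *\<^sub>R y)) * h y))"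
      by (rule integral_mult_right_zero[symmetric])
    also have "\<dots> \<le> (LINT y|lborel. (C * r) * ((1 + norm y) ^ (m + N) * norm (h y)))"
    proof (rule integral_mono')
      show "integrable lborel (\<lambda>y. (C * r) * ((1 + norm y) ^ (m + N) * norm (h y)))"
        by (intro integrable_mult_right rapid_weighted_integrable h)
      fix y
      show "(1 + norm x) ^ N * norm ((fourier w (r *\<^sub>R x - r *\<^sub>R y) - T (r *\<^sub>R x) (r *\<^sub>R y)) * h y)
          \<le> (C * r) * ((1 + norm y) ^ (m + N) * norm (h y))"
        using mult_right_mono[OF pt[of y], of "norm (h y)"] by (simp only: norm_mult mult.assoc norm_ge_zero)
      show "0 \<le> (C * r) * ((1 + norm y) ^ (m + N) * norm (h y))"
        using C(1) r by simp
    qed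
    also have "\<dots> = (C * r) * K" unfolding K_def by (rule integral_mult_right_zero)
    finally show ?thesis by (simp only: mult_ac)
  qed
  moreover have "C * K \<ge> 0" using C(1) K by simp
  ultimately show ?thesis by blast
qed

lemma monom_symbol_scale: "monom_symbol is (s *\<^sub>R \<xi>) = of_real (s ^ length is) * monom_symbol is \<xi>"
  by (induction "is") (simp_all add: monom_symbol_def mult_ac)

lemma bump_monom_symbol: "bump f \<Longrightarrow> bump (\<lambda>\<xi>. monom_symbol is \<xi> * f \<xi>)"
proof (induction "is")
  case (Cons i "is")
  have "(\<lambda>\<xi>. monom_symbol (i # is) \<xi> * f \<xi>)
    = (\<lambda>\<xi>. (- 2 * of_real pi * \<i>) * (complex_of_real (\<xi> $ i) * (monom_symbol is \<xi> * f \<xi>)))"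
    by (simp add: monom_symbol_def mult.assoc)
  moreover have "bump \<dots>" by (rule bump_cmult[OF bump_mult_coord[OF Cons.IH[OF Cons.prems]]])
  ultimately show ?case by (simp only:)
qed (simp add: monom_symbol_def)

text \<open>All derivatives of the cut-off test function obey the same bound O(r), since each of
  them is again a low-frequency cutoff with a modified bump as symbol. Continuity of
  \<open>v\<close> involves finitely many of these seminorms, and r = 2^-k.\<close>

lemma tempered_low_frequency_limit:
  fixes \<eta> h :: "real^'n::finite \<Rightarrow> complex" and v :: "'n distribution"
  assumes v: "tempered v" and \<eta>: "bump \<eta>" and h: "rapid h"
    and ann: "\<And>P. polynomial_function P \<Longrightarrow> (LINT y|lborel. P y * h y) = 0"
  shows "(\<lambda>k. v (fourier (\<lambda>\<xi>. \<eta> (2 ^ k *\<^sub>R \<xi>) * inv_fourier h \<xi>))) \<longlonglongrightarrow> 0"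
proof -
  define G where "G r = (\<lambda>\<xi>. \<eta> (inverse r *\<^sub>R \<xi>) * inv_fourier h \<xi>)" for r
  have rapid_G: "rapid (G r)" if "0 < r" for r
  proof -
    have "rapid (\<lambda>\<xi>. inv_fourier h \<xi> * \<eta> (inverse r *\<^sub>R \<xi>))"
      by (rule rapid_mult[where k = 0, OF bump_rapid[OF bump_scale[OF \<eta>]] inv_fourier_measurable[OF h]])
         (use that inv_fourier_norm_le[OF h] in auto)
    then show ?thesis by (simp only: G_def mult.commute)
  qed
  have "\<exists>C\<ge>0. \<forall>r x. 0 < r \<longrightarrow> r \<le> 1 \<longrightarrow> (1 + norm x) ^ N * norm (iter_deriv is (fourier (G r)) x) \<le> C * r" for N "is"
  proof -
    obtain C where C: "C \<ge> 0" "\<And>r x. 0 < r \<Longrightarrow> r \<le> 1 \<Longrightarrow> (1 + norm x) ^ N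
        * norm (fourier (\<lambda>\<xi>. monom_symbol is (inverse r *\<^sub>R \<xi>) * \<eta> (inverse r *\<^sub>R \<xi>) * inv_fourier h \<xi>) x) \<le> C * r"
      using fourier_low_frequency_bound[where N = N, OF bump_monom_symbol[OF \<eta>, of "is"] h ann] by blast
    have "(1 + norm x) ^ N * norm (iter_deriv is (fourier (G r)) x) \<le> C * r" if r: "0 < r" "r \<le> 1" for r x
    proof -
      \<comment> \<open>Homogeneity makes the monomial a function of xi / r, so that together with
        \<open>\<eta>\<close> it forms one bump dilated by r; the factor r^(length of
        \<open>is\<close>) is at most 1.\<close>
      have "monom_symbol is \<xi> * G r \<xi> = of_real (r ^ length is) *
          (monom_symbol is (inverse r *\<^sub>R \<xi>) * \<eta> (inverse r *\<^sub>R \<xi>) * inv_fourier h \<xi>)" for \<xi>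
      proof -
        have "monom_symbol is \<xi> = of_real (r ^ length is) * monom_symbol is (inverse r *\<^sub>R \<xi>)"
          unfolding monom_symbol_scale[symmetric] using r by simp
        then show ?thesis by (simp only: G_def mult.assoc)
      qed
      then have "norm (iter_deriv is (fourier (G r)) x) = r ^ length is *
          norm (fourier (\<lambda>\<xi>. monom_symbol is (inverse r *\<^sub>R \<xi>) * \<eta> (inverse r *\<^sub>R \<xi>) * inv_fourier h \<xi>) x)"
        unfolding iter_deriv_fourier[OF rapid_G[OF r(1)]] using r
        by (simp only: fourier_cmult) (simp add: norm_mult norm_power)
      also have "\<dots> \<le> norm (fourier (\<lambda>\<xi>. monom_symbol is (inverse r *\<^sub>R \<xi>) * \<eta> (inverse r *\<^sub>R \<xi>) * inv_fourier h \<xi>) x)"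
        using r by (intro mult_left_le_one_le) (auto simp: power_le_one)
      finally have "(1 + norm x) ^ N * norm (iter_deriv is (fourier (G r)) x) \<le> (1 + norm x) ^ N *
          norm (fourier (\<lambda>\<xi>. monom_symbol is (inverse r *\<^sub>R \<xi>) * \<eta> (inverse r *\<^sub>R \<xi>) * inv_fourier h \<xi>) x)"
        by (rule mult_left_mono) simp
      also have "\<dots> \<le> C * r" by (rule C(2)[OF r])
      finally show ?thesis .
    qed
    then show ?thesis using C(1) by blast
  qed
  then have "\<forall>N is. \<exists>C. C \<ge> 0 \<and> (\<forall>r x. 0 < r \<longrightarrow> r \<le> 1 \<longrightarrow>
      (1 + norm x) ^ N * norm (iter_deriv is (fourier (G r)) x) \<le> C * r)" by blast
  then obtain C where C: "\<And>N is. C N is \<ge> 0" "\<And>N is r x. 0 < r \<Longrightarrow> r \<le> 1 \<Longrightarrow>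
      (1 + norm x) ^ N * norm (iter_deriv is (fourier (G r)) x) \<le> C N is * r"
    unfolding choice_iff by blast
  obtain D N where D: "\<And>f. f \<in> schwartz \<Longrightarrow> norm (v f) \<le> D * schwartz_norm N f"
    using v unfolding tempered_def schwartz_norm_def by blast
  define K where "K = \<bar>D\<bar> * (\<Sum>is\<in>{is. length is \<le> N}. C N is)"
  have bound: "norm (v (fourier (G r))) \<le> K * r" if r: "0 < r" "r \<le> 1" for r
  proof -
    \<comment> \<open>\<open>G r\<close> itself is only known to be rapid; the Schwartz bounds for
      its transform are the weighted estimates just collected.\<close>
    have S: "fourier (G r) \<in> schwartz"
      using C(2)[OF r] by (intro schwartzI smooth_fourier rapid_G r) blast
    have "norm (v (fourier (G r))) \<le> D * schwartz_norm N (fourier (G r))" by (rule D[OF S])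
    also have "\<dots> \<le> \<bar>D\<bar> * schwartz_norm N (fourier (G r))"
      by (intro mult_right_mono schwartz_norm_nonneg S) auto
    also have "\<dots> \<le> \<bar>D\<bar> * (\<Sum>is\<in>{is. length is \<le> N}. C N is * r)"
      unfolding schwartz_norm_def
      by (intro mult_left_mono sum_mono schwartz_seminorm_least C(2) r) auto
    finally show ?thesis by (simp only: K_def sum_distrib_right mult.assoc)
  qed
  have "norm (v (fourier (\<lambda>\<xi>. \<eta> (2 ^ k *\<^sub>R \<xi>) * inv_fourier h \<xi>))) \<le> K * (1 / 2) ^ k" for k
    using bound[of "(1 / 2) ^ k"] by (simp add: G_def power_le_one power_one_over)
  moreover have "(\<lambda>k. K * (1 / 2) ^ k) \<longlonglongrightarrow> 0"
    using tendsto_mult[OF tendsto_const LIMSEQ_realpow_zero[of "1 / 2"], of K] by simp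
  ultimately show ?thesis
    by (rule Lim_null_comparison[OF always_eventually[OF allI]])
qed

section \<open>Changing scale in the reproducing formula\<close>

lemma inv_fourier_eq_fourier: "inv_fourier f x = fourier f (- x)"
  by (simp add: inv_fourier_def fourier_def inner_commute)

text \<open>Dilating \<open>h\<close> produces a factor s^n inside the transform, and the
  substitution xi -> xi / s absorbs exactly this factor. The net effect of conjugating by a dilation
  is thus a rescaled symbol.\<close>

lemma dilation_conjugates_symbol:
  fixes g h :: "real^'n::finite \<Rightarrow> complex"
  assumes g [measurable]: "g \<in> borel_measurable borel" and h: "rapid h" and s: "s > 0"
  shows "(\<lambda>x. fourier (\<lambda>\<xi>. g \<xi> * inv_fourier (\<lambda>y. h (inverse s *\<^sub>R y)) \<xi>) (s *\<^sub>R x))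
    = fourier (\<lambda>\<xi>. g (inverse s *\<^sub>R \<xi>) * inv_fourier h \<xi>)"
proof
  fix x
  note [measurable] = rapid_measurable[OF h] inv_fourier_measurable[OF h]
  have "inv_fourier (\<lambda>y. h (inverse s *\<^sub>R y)) \<xi> = of_real (s ^ CARD('n)) * inv_fourier h (s *\<^sub>R \<xi>)" for \<xi>
    unfolding inv_fourier_eq_fourier fourier_scale[OF rapid_measurable[OF h] s] by simp
  then have "fourier (\<lambda>\<xi>. g \<xi> * inv_fourier (\<lambda>y. h (inverse s *\<^sub>R y)) \<xi>) (s *\<^sub>R x)
    = of_real (s ^ CARD('n)) * fourier (\<lambda>\<xi>. g \<xi> * inv_fourier h (s *\<^sub>R \<xi>)) (s *\<^sub>R x)"
    by (simp only: mult.left_commute[of "g _" "of_real (s ^ CARD('n))"] fourier_cmult)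
  also have "\<dots> = fourier (\<lambda>\<xi>. g (inverse s *\<^sub>R \<xi>) * inv_fourier h (s *\<^sub>R (inverse s *\<^sub>R \<xi>))) x"
    by (rule fourier_scale[OF _ s, symmetric]) measurable
  finally show "fourier (\<lambda>\<xi>. g \<xi> * inv_fourier (\<lambda>y. h (inverse s *\<^sub>R y)) \<xi>) (s *\<^sub>R x)
    = fourier (\<lambda>\<xi>. g (inverse s *\<^sub>R \<xi>) * inv_fourier h \<xi>) x" using s by simp
qed

lemma LP_low_eq: "LP_low \<eta> v \<psi> = v (fourier (\<lambda>\<xi>. \<eta> \<xi> * inv_fourier \<psi> \<xi>))"
  by (simp add: LP_low_def inv_fourier_distr_def mult_distr_def fourier_distr_def)

lemma LP_block_eq:
  "LP_block \<phi> j v \<psi> = v (fourier (\<lambda>\<xi>. \<phi> ((2 powi (- j)) *\<^sub>R \<xi>) * inv_fourier \<psi> \<xi>))"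
  by (simp add: LP_block_def inv_fourier_distr_def mult_distr_def fourier_distr_def)

text \<open>Applying the inhomogeneous formula to the dilates of \<open>v\<close> moves the low-frequency cutoff
  to an arbitrary scale, so no compatibility between \<open>\<eta>\<close> and \<open>\<phi>\<close> has to be extracted.\<close>

lemma calderon_shifted:
  fixes \<phi> \<eta> h :: "real^'n::finite \<Rightarrow> complex" and v :: "'n distribution"
  assumes calderon: "\<And>v :: 'n distribution. tempered v \<Longrightarrow>
      tempered_tendsto (\<lambda>N \<psi>. LP_low \<eta> v \<psi> + (\<Sum>j=1..N. LP_block \<phi> (int j) v \<psi>)) v sequentially"
    and v: "tempered v" and \<phi>: "bump \<phi>" and \<eta>: "bump \<eta>" and h: "h \<in> schwartz"
  shows "(\<lambda>N. v (fourier (\<lambda>\<xi>. \<eta> (2 ^ k *\<^sub>R \<xi>) * inv_fourier h \<xi>))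
      + (\<Sum>j=1..N. LP_block \<phi> (int j - int k) v h)) \<longlonglongrightarrow> v h"
proof -
  \<comment> \<open>With s = 2^-k the conjugation replaces a symbol g by g(2^k xi): block j turns
    into block j - k, and the cutoff moves to scale 2^-k. Testing \<open>w\<close> on
    \<open>hs\<close> undoes the dilation, so the limit is still the value of \<open>v\<close> at
    \<open>h\<close>.\<close>
  define s :: real where "s = (1 / 2) ^ k"
  have s: "s > 0" "inverse s = 2 ^ k" by (simp_all add: s_def power_one_over)
  define w where "w f = v (\<lambda>x. f (s *\<^sub>R x))" for f
  define hs where "hs = (\<lambda>y. h (inverse s *\<^sub>R y))"
  have hs: "hs \<in> schwartz" unfolding hs_def using s(1) h by (intro schwartz_scale) auto
  have low: "LP_low \<eta> w hs = v (fourier (\<lambda>\<xi>. \<eta> (2 ^ k *\<^sub>R \<xi>) * inv_fourier h \<xi>))"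
    unfolding LP_low_eq w_def hs_def
      dilation_conjugates_symbol[OF bump_measurable[OF \<eta>] schwartz_rapid[OF h] s(1)]
    by (simp only: s(2))
  have block: "LP_block \<phi> (int j) w hs = LP_block \<phi> (int j - int k) v h" for j
  proof -
    have m: "(\<lambda>\<xi>. \<phi> ((2 powi (- int j)) *\<^sub>R \<xi>)) \<in> borel_measurable borel"
      by (intro bump_measurable bump_scale \<phi>) simp
    have "(2::real) powi (- int j) * 2 ^ k = 2 powi (- (int j - int k))"
      by (simp add: power_int_diff power_int_minus divide_inverse mult.commute)
    then show ?thesis
      unfolding LP_block_eq w_def hs_def
        dilation_conjugates_symbol[OF m schwartz_rapid[OF h] s(1)]
      by (simp only: s(2) scaleR_scaleR)
  qed
  have "w hs = v h" using s(1) by (simp add: w_def hs_def)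
  moreover have "(\<lambda>N. LP_low \<eta> w hs + (\<Sum>j=1..N. LP_block \<phi> (int j) w hs)) \<longlonglongrightarrow> w hs"
    using calderon[of w] tempered_scale[OF s(1) v] hs unfolding tempered_tendsto_def w_def by blast
  ultimately show ?thesis by (simp only: low block)
qed

text \<open>Here a k is the cutoff at scale 2^-k, and the sum of blocks is cut into A k (indices at
  most 0) and B N (indices at least 1). The formula at scale k = 0 gives the limit of B. Comparing
  it with the formula at scale k, by uniqueness of limits, yields the exact telescoping identity A k
  = a 0 - a k. The double limit is then a sum of two single limits, in which a 0 cancels.\<close>

lemma homogeneous_calderon:
  fixes \<phi> \<eta> h :: "real^'n::finite \<Rightarrow> complex" and v :: "'n distribution"
  assumes calderon: "\<And>v :: 'n distribution. tempered v \<Longrightarrow>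
      tempered_tendsto (\<lambda>N \<psi>. LP_low \<eta> v \<psi> + (\<Sum>j=1..N. LP_block \<phi> (int j) v \<psi>)) v sequentially"
    and v: "tempered v" and \<phi>: "bump \<phi>" and \<eta>: "bump \<eta>" and h: "h \<in> schwartz"
    and ann: "\<And>P. polynomial_function P \<Longrightarrow> (LINT y|lborel. P y * h y) = 0"
  shows "((\<lambda>(M, N). \<Sum>j\<in>{- int M..int N}. LP_block \<phi> j v h) \<longlongrightarrow> v h) (sequentially \<times>\<^sub>F sequentially)"
proof -
  define a where "a k = v (fourier (\<lambda>\<xi>. \<eta> (2 ^ k *\<^sub>R \<xi>) * inv_fourier h \<xi>))" for k
  define b where "b j = LP_block \<phi> j v h" for j
  define A where "A k = (\<Sum>j\<in>{1 - int k..0}. b j)" for k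
  define B where "B N = (\<Sum>j\<in>{1..int N}. b j)" for N
  have split: "(\<Sum>j\<in>{1 - int k..int N}. b j) = A k + B N" for k N
  proof -
    have "{1 - int k..int N} = {1 - int k..0} \<union> {1..int N}" by auto
    then show ?thesis unfolding A_def B_def by (simp add: sum.union_disjoint)
  qed
  have lim: "(\<lambda>N. a k + (A k + B N)) \<longlonglongrightarrow> v h" for k
  proof -
    \<comment> \<open>Shifting the index by k maps 1..N+k onto 1-k..N; passing from N to N + k drops
      an initial segment of the sequence, which leaves its limit unchanged.\<close>
    have "(\<Sum>j=1..N + k. b (int j - int k)) = (\<Sum>j\<in>{1 - int k..int N}. b j)" for N
      by (rule sum.reindex_bij_witness[of _ "\<lambda>i. nat (i + int k)" "\<lambda>j. int j - int k"]) auto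
    moreover have "(\<lambda>N. a k + (\<Sum>j=1..N + k. b (int j - int k))) \<longlonglongrightarrow> v h"
      using LIMSEQ_ignore_initial_segment[OF calderon_shifted[OF calderon v \<phi> \<eta> h, of k], of k]
      unfolding a_def b_def .
    ultimately show ?thesis by (simp only: split)
  qed
  have limB: "B \<longlonglongrightarrow> v h - a 0"
    using tendsto_diff[OF lim[of 0] tendsto_const[of "a 0"]] by (simp add: A_def)
  have A: "A k = a 0 - a k" for k
  proof -
    have "(\<lambda>N. a k + (A k + B N)) \<longlonglongrightarrow> a k + (A k + (v h - a 0))"
      by (intro tendsto_intros limB)
    from LIMSEQ_unique[OF this lim] show ?thesis by (simp add: algebra_simps)
  qed
  have "a \<longlonglongrightarrow> 0"
    unfolding a_def[abs_def] by (rule tempered_low_frequency_limit[OF v \<eta> schwartz_rapid[OF h] ann])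
  \<comment> \<open>The sum A k starts at index 1 - k, so the lower end -M corresponds to k = M +
    1.\<close>
  then have "(\<lambda>M. a (Suc M)) \<longlonglongrightarrow> 0" by (rule LIMSEQ_Suc)
  then have "(\<lambda>M. A (Suc M)) \<longlonglongrightarrow> a 0 - 0" unfolding A by (intro tendsto_intros)
  then have "((\<lambda>p. A (Suc (fst p)) + B (snd p)) \<longlongrightarrow> (a 0 - 0) + (v h - a 0)) (sequentially \<times>\<^sub>F sequentially)"
    by (intro tendsto_add filterlim_compose[OF _ filterlim_fst] filterlim_compose[OF limB filterlim_snd])
  moreover have "(\<lambda>(M, N). \<Sum>j\<in>{- int M..int N}. b j) = (\<lambda>p. A (Suc (fst p)) + B (snd p))"
    by (simp add: split[symmetric] case_prod_unfold)
  ultimately show ?thesis unfolding b_def by simp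
qed

theorem theorem8p2:
  fixes \<alpha> :: real
    and \<phi> \<eta> :: "real^'n::finite \<Rightarrow> complex"
    and u :: "'n distribution"
  assumes "\<forall>k::int. \<alpha> \<noteq> pi * of_int k"
    and "\<phi> \<in> Cc_infty (- {0})"
    and "supp \<phi> \<subseteq> {\<xi>. 1/2 \<le> norm \<xi> \<and> norm \<xi> \<le> 2}"
    and "\<forall>\<xi>. \<xi> \<noteq> 0 \<longrightarrow> ((\<lambda>j::int. \<phi> ((2 powi (- j)) *\<^sub>R \<xi>)) has_sum 1) UNIV"
    and "\<eta> \<in> Cc_infty UNIV"
    and "supp \<eta> \<subseteq> {\<xi>. norm \<xi> \<le> 2}"
    and "\<forall>\<xi>. norm \<xi> \<le> 1 \<longrightarrow> \<eta> \<xi> = 1"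
    and "\<forall>v :: 'n distribution. tempered v \<longrightarrow>
           tempered_tendsto
             (\<lambda>N \<psi>. LP_low \<eta> v \<psi> + (\<Sum>j=1..N. LP_block \<phi> (int j) v \<psi>)) v sequentially"
    and "tempered u"
  shows "tempered_tendsto
           (\<lambda>N \<psi>. chirp_low \<alpha> \<eta> u \<psi> + (\<Sum>j=1..N. chirp_block \<alpha> \<phi> (int j) u \<psi>)) u sequentially
       \<and> quotient_tendsto \<alpha>
           (\<lambda>(M, N) \<psi>. \<Sum>j\<in>{- int M..int N}. chirp_block \<alpha> \<phi> j u \<psi>) u
           (sequentially \<times>\<^sub>F sequentially)"
proof -
  define v where "v = mult_distr (chirp \<alpha>) u"
  have v: "tempered v"
    unfolding v_def by (rule tempered_mult_distr[OF multiplier_chirp \<open>tempered u\<close>])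
  note calderon = assms(8)[rule_format]
  have schwartz: "(\<lambda>x. inv_chirp \<alpha> x * \<psi> x) \<in> schwartz" if "\<psi> \<in> schwartz" for \<psi> :: "real^'n \<Rightarrow> complex"
    by (rule schwartz_mult[OF multiplier_inv_chirp that])
  have low: "chirp_low \<alpha> \<eta> u \<psi> = LP_low \<eta> v (\<lambda>x. inv_chirp \<alpha> x * \<psi> x)"
    and block: "chirp_block \<alpha> \<phi> j u \<psi> = LP_block \<phi> j v (\<lambda>x. inv_chirp \<alpha> x * \<psi> x)"
    and whole: "v (\<lambda>x. inv_chirp \<alpha> x * \<psi> x) = u \<psi>" for j \<psi>
  proof -
    have "chirp \<alpha> x * (inv_chirp \<alpha> x * \<psi> x) = \<psi> x" for x
      by (simp add: chirp_def inv_chirp_def mult.assoc[symmetric] exp_add[symmetric])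
    then show "v (\<lambda>x. inv_chirp \<alpha> x * \<psi> x) = u \<psi>" by (simp only: v_def mult_distr_def)
  qed (simp_all add: chirp_low_def chirp_block_def v_def mult_distr_def[of "inv_chirp \<alpha>"])
  show ?thesis
  proof
    show "tempered_tendsto
           (\<lambda>N \<psi>. chirp_low \<alpha> \<eta> u \<psi> + (\<Sum>j=1..N. chirp_block \<alpha> \<phi> (int j) u \<psi>)) u sequentially"
      unfolding tempered_tendsto_def low block
    proof
      fix \<psi> :: "real^'n \<Rightarrow> complex"
      assume "\<psi> \<in> schwartz"
      from bspec[OF calderon[OF v, unfolded tempered_tendsto_def] schwartz[OF this]]
      show "(\<lambda>N. LP_low \<eta> v (\<lambda>x. inv_chirp \<alpha> x * \<psi> x)
          + (\<Sum>j=1..N. LP_block \<phi> (int j) v (\<lambda>x. inv_chirp \<alpha> x * \<psi> x))) \<longlonglongrightarrow> u \<psi>"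
        by (simp only: whole)
    qed
    show "quotient_tendsto \<alpha>
           (\<lambda>(M, N) \<psi>. \<Sum>j\<in>{- int M..int N}. chirp_block \<alpha> \<phi> j u \<psi>) u
           (sequentially \<times>\<^sub>F sequentially)"
      unfolding quotient_tendsto_def
    proof (intro ballI impI)
      fix \<psi> :: "real^'n \<Rightarrow> complex"
      assume \<psi>: "\<psi> \<in> schwartz" and ann: "\<forall>p\<in>chirp_polys \<alpha>. (LINT x|lborel. p x * \<psi> x) = 0"
      \<comment> \<open>The pairing is bilinear, so the inverse chirp can be moved from the
        polynomial to \<open>\<psi>\<close>: annihilating \<open>chirp_polys \<alpha>\<close>
        becomes the vanishing of all moments of the chirped test function.\<close>
      have "(LINT x|lborel. P x * (inv_chirp \<alpha> x * \<psi> x)) = 0" if "polynomial_function P" for P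
      proof -
        have "(LINT x|lborel. (inv_chirp \<alpha> x * P x) * \<psi> x) = 0"
          by (rule bspec[OF ann]) (use that in \<open>auto simp: chirp_polys_def\<close>)
        then show ?thesis by (simp add: mult_ac)
      qed
      from homogeneous_calderon[OF calderon v Cc_infty_bump[OF assms(2)] Cc_infty_bump[OF assms(5)] schwartz[OF \<psi>] this]
      show "((\<lambda>i. (case i of (M, N) \<Rightarrow> \<lambda>\<psi>. \<Sum>j\<in>{- int M..int N}. chirp_block \<alpha> \<phi> j u \<psi>) \<psi>) \<longlongrightarrow> u \<psi>)
          (sequentially \<times>\<^sub>F sequentially)"
        unfolding block whole by (simp add: case_prod_unfold)
    qed
  qed
qed

end
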